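(* Let $K$ be a field and $S=K[x_1,\ldots,x_n]$. Fix positive integers $d$ and $e_1,\ldots,e_n$ with $1\le e_1\le\cdots\le e_n\le d$. Let $t=d+n-1-\sum_{i=1}^ne_i$, and let $I=I_{(d;e_1,\ldots,e_n)}$ be the ideal of Veronese type of $S$ indexed by $d$ and $(e_1,\ldots,e_n)$. Then $$\operatorname{depth}S/I=t.$$
   Context: The ideal of Veronese type $I_{(d;e_1,\ldots,e_n)}$ is the ideal of $S$ generated by those monomials $x_1^{a_1}\cdots x_n^{a_n}$ of degree $d$ with $a_i\le e_i$ for each $1\le i\le n$. Depth is with respect to $(x_1,\ldots,x_n)$.
   Formalization: The formal theorem adds the condition 0 ≤ t ≤ n; without it the equation fails, e.g. for n=d=2, e=(2,2) (depth 0, t=-1) or n=1, d=3, e=(1) (depth 1, t=2), and only false instances are excluded. *)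

theory Defs
  imports
    "HOL-Algebra.QuotRing"
    "HOL-Algebra.Module"
    "HOL-Library.Poly_Mapping"
    "HOL-Library.Extended_Nat"
begin

section \<open>Depth of a module with respect to an ideal\<close>

text \<open>
  The submodule \<open>(a\<^sub>1, \<dots>, a\<^sub>k) M\<close> of \<open>M\<close>, as the set of all sums
  \<open>a\<^sub>1 x\<^sub>1 + \<dots> + a\<^sub>k x\<^sub>k\<close> with \<open>x\<^sub>i\<close> in \<open>M\<close>.
\<close>

fun list_smult :: "('r, 'm, 'b) module_scheme \<Rightarrow> 'r list \<Rightarrow> 'm set" where
  "list_smult M [] = {\<zero>\<^bsub>M\<^esub>}"
| "list_smult M (a # as) =
     {(a \<odot>\<^bsub>M\<^esub> x) \<oplus>\<^bsub>M\<^esub> y | x y. x \<in> carrier M \<and> y \<in> list_smult M as}"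

text \<open>
  The middle condition says that \<open>a\<^sub>i\<close> is not a zero divisor on
  \<open>M / (a\<^sub>1, \<dots>, a\<^sub>i\<^sub>-\<^sub>1) M\<close>.
\<close>

definition regular_sequence ::
    "('r, 'a) ring_scheme \<Rightarrow> ('r, 'm, 'b) module_scheme \<Rightarrow> 'r list \<Rightarrow> bool" where
  "regular_sequence R M as \<longleftrightarrow>
     set as \<subseteq> carrier R \<and>
     (\<forall>i < length as. \<forall>x \<in> carrier M.
        (as ! i) \<odot>\<^bsub>M\<^esub> x \<in> list_smult M (take i as) \<longrightarrow> x \<in> list_smult M (take i as)) \<and>
     list_smult M as \<noteq> carrier M"

text \<open>
  The value is extended so that the supremum is never a junk value. The zero module has no
  regular sequences in this sense, not even the empty one, and gets depth 0.
\<close>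

definition depth ::
    "('r, 'a) ring_scheme \<Rightarrow> 'r set \<Rightarrow> ('r, 'm, 'b) module_scheme \<Rightarrow> enat" where
  "depth R J M = Sup {enat (length as) | as. set as \<subseteq> J \<and> regular_sequence R M as}"

definition quotient_module :: "('r, 'a) ring_scheme \<Rightarrow> 'r set \<Rightarrow> ('r, 'r set) module" where
  "quotient_module R I =
     ring.extend (R Quot I) (module.fields (\<lambda>r X. (I +>\<^bsub>R\<^esub> r) \<otimes>\<^bsub>R Quot I\<^esub> X))"

lemma quotient_module_sel [simp]:
  "carrier (quotient_module R I) = carrier (R Quot I)"
  "mult (quotient_module R I) = mult (R Quot I)"
  "one (quotient_module R I) = one (R Quot I)"
  "zero (quotient_module R I) = zero (R Quot I)"
  "add (quotient_module R I) = add (R Quot I)"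
  "smult (quotient_module R I) r X = (I +>\<^bsub>R\<^esub> r) \<otimes>\<^bsub>R Quot I\<^esub> X"
  by (simp_all add: quotient_module_def ring.defs module.defs)

lemma quotient_module_is_module:
  assumes "cring R" and "ideal I R"
  shows "Module.module R (quotient_module R I)"
proof -
  interpret I: ideal I R by fact
  interpret Q: cring "R Quot I" using I.quotient_is_cring[OF assms(1)] .
  note h = I.rcos_ring_hom
  have g: "abelian_group (quotient_module R I)"
    by (rule abelian_groupI) (use Q.add.l_inv_ex in \<open>simp_all add: Q.a_ac\<close>)
  show ?thesis
    by (rule Module.moduleI)
       (use h in \<open>auto simp: assms(1) g ring_hom_closed ring_hom_add ring_hom_mult ring_hom_one
          Q.l_distr Q.r_distr Q.m_assoc\<close>)
qed


section \<open>Polynomial rings\<close>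

text \<open>
  A polynomial is a finitely supported map from exponent vectors to coefficients, and an exponent
  vector a finitely supported map from the indices of the variables to \<open>nat\<close>. The ring
  \<open>K[x\<^sub>1, \<dots>, x\<^sub>n]\<close> consists of the polynomials in which only the variables with index in
  \<open>{1..n}\<close> occur.
\<close>

type_synonym 'k mpoly = "(nat \<Rightarrow>\<^sub>0 nat) \<Rightarrow>\<^sub>0 'k"

definition mpoly_ring :: "nat \<Rightarrow> ('k::field) mpoly ring" where
  "mpoly_ring n =
     \<lparr>carrier = {p. \<forall>a \<in> Poly_Mapping.keys p. Poly_Mapping.keys a \<subseteq> {1..n}},
      mult = (*), one = 1, zero = 0, add = (+)\<rparr>"

lemma mpoly_ring_cring: "cring (mpoly_ring n :: ('k::field) mpoly ring)"
proof (rule cringI)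
  let ?S = "mpoly_ring n :: 'k mpoly ring"
  show "abelian_group ?S"
  proof (rule abelian_groupI)
    fix p q assume "p \<in> carrier ?S" "q \<in> carrier ?S"
    then show "p \<oplus>\<^bsub>?S\<^esub> q \<in> carrier ?S"
      using keys_add[of p q] by (auto simp: mpoly_ring_def)
  next
    fix p assume "p \<in> carrier ?S"
    then show "\<exists>q\<in>carrier ?S. q \<oplus>\<^bsub>?S\<^esub> p = \<zero>\<^bsub>?S\<^esub>"
      by (intro bexI[of _ "- p"]) (auto simp: mpoly_ring_def in_keys_iff)
  qed (auto simp: mpoly_ring_def algebra_simps)
  show "Group.comm_monoid ?S"
  proof (rule comm_monoidI)
    fix p q assume *: "p \<in> carrier ?S" "q \<in> carrier ?S"
    {
      fix c assume "c \<in> Poly_Mapping.keys (p * q)"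
      then obtain a b where "c = a + b" "a \<in> Poly_Mapping.keys p" "b \<in> Poly_Mapping.keys q"
        using keys_mult[of p q] by auto
      then have "Poly_Mapping.keys c \<subseteq> {1..n}"
        using * keys_add[of a b] by (force simp: mpoly_ring_def)
    }
    then show "p \<otimes>\<^bsub>?S\<^esub> q \<in> carrier ?S"
      by (simp add: mpoly_ring_def)
  qed (auto simp: mpoly_ring_def algebra_simps)
qed (auto simp: mpoly_ring_def algebra_simps)

definition mon :: "(nat \<Rightarrow>\<^sub>0 nat) \<Rightarrow> ('k::field) mpoly" where
  "mon a = Poly_Mapping.single a 1"

definition var :: "nat \<Rightarrow> ('k::field) mpoly" where
  "var i = mon (Poly_Mapping.single i 1)"

definition max_ideal :: "nat \<Rightarrow> ('k::field) mpoly set" where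
  "max_ideal n = Idl\<^bsub>mpoly_ring n\<^esub> (var ` {1..n})"

definition veronese_ideal :: "nat \<Rightarrow> nat \<Rightarrow> (nat \<Rightarrow> nat) \<Rightarrow> ('k::field) mpoly set" where
  "veronese_ideal n d e = Idl\<^bsub>mpoly_ring n\<^esub>
     {mon a | a. Poly_Mapping.keys a \<subseteq> {1..n} \<and>
        (\<Sum>i = 1..n. Poly_Mapping.lookup a i) = d \<and>
        (\<forall>i \<in> {1..n}. Poly_Mapping.lookup a i \<le> e i)}"

end

theory Submission
  imports Defs
begin

text \<open>
  Upper bound. Put \<open>u = e - (0, \<dots>, 0, 1, \<dots>, 1)\<close> with \<open>t\<close> zeros. Then \<open>x\<^sup>u\<close> has degree \<open>d - 1\<close> and
  \<open>(x\<^bsub>t+1\<^esub>, \<dots>, x\<^sub>n) x\<^sup>u\<close> lies in \<open>I\<close>. If \<open>f\<^sub>1, \<dots>, f\<^sub>s\<close> is regular with \<open>s > t\<close>, then so is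
  \<open>f\<^sub>1\<^sup>d, \<dots>, f\<^sub>s\<^sup>d\<close>; modulo \<open>x\<^bsub>t+1\<^esub>, \<dots>, x\<^sub>n\<close> these powers are algebraically dependent, which
  gives a nontrivial polynomial relation \<open>F(f\<^sub>1\<^sup>d, \<dots>, f\<^sub>s\<^sup>d) x\<^sup>u \<in> I\<close>. Regularity turns it into
  \<open>x\<^sup>u \<in> I + (f\<^sub>1\<^sup>d, \<dots>, f\<^sub>s\<^sup>d)\<close>, but this ideal contains no terms of degree \<open>d - 1\<close>.

  Lower bound. The elementary symmetric polynomials \<open>E\<^sub>t, \<dots>, E\<^sub>1\<close> are a regular sequence on every
  \<open>K[x\<^sub>i : i \<in> V]\<close> with \<open>|V| \<ge> t\<close>, and \<open>S/I\<close> has a filtration with such quotients because the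
  ideals \<open>(I : x\<^sub>i)\<close> and \<open>(I, x\<^sub>i)\<close> are again of the same type. Elementary symmetric polynomials,
  unlike general linear forms, are available over finite fields too.
\<close>

section \<open>Weakly regular sequences modulo an ideal\<close>

fun list_monom :: "'a::comm_ring_1 list \<Rightarrow> nat list \<Rightarrow> 'a" where
  "list_monom (a # as) (k # ks) = a ^ k * list_monom as ks"
| "list_monom _ _ = 1"

text \<open>K[x_1, ..., x_n] is a subset of the type of polynomials in countably many variables.
  Working in a subset of a type class ring keeps the operations of the type; the ring record returns
  only at the interface with the quotient module.\<close>

locale comm_subring =
  fixes R :: "'a::comm_ring_1 set"
  assumes zero_mem [simp]: "0 \<in> R"
    and one_mem [simp]: "1 \<in> R"
    and add_mem [simp]: "x \<in> R \<Longrightarrow> y \<in> R \<Longrightarrow> x + y \<in> R"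
    and minus_mem [simp]: "x \<in> R \<Longrightarrow> - x \<in> R"
    and mult_mem [simp]: "x \<in> R \<Longrightarrow> y \<in> R \<Longrightarrow> x * y \<in> R"
begin

lemma diff_mem [simp]: "x \<in> R \<Longrightarrow> y \<in> R \<Longrightarrow> x - y \<in> R"
  using add_mem[of x "- y"] by simp

lemma power_mem [simp]: "x \<in> R \<Longrightarrow> x ^ k \<in> R"
  by (induction k) auto

lemma sum_mem: "(\<And>x. x \<in> X \<Longrightarrow> f x \<in> R) \<Longrightarrow> sum f X \<in> R"
  by (induction X rule: infinite_finite_induct) auto

definition ideal_in :: "'a set \<Rightarrow> bool" where
  "ideal_in J \<longleftrightarrow> J \<subseteq> R \<and> 0 \<in> J \<and> (\<forall>x\<in>J. \<forall>y\<in>J. x + y \<in> J) \<and> (\<forall>r\<in>R. \<forall>x\<in>J. r * x \<in> J)"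

lemma ideal_inD:
  assumes "ideal_in J"
  shows "x \<in> J \<Longrightarrow> x \<in> R" "0 \<in> J" "x \<in> J \<Longrightarrow> y \<in> J \<Longrightarrow> x + y \<in> J"
    "r \<in> R \<Longrightarrow> x \<in> J \<Longrightarrow> r * x \<in> J"
    "x \<in> J \<Longrightarrow> - x \<in> J" "x \<in> J \<Longrightarrow> y \<in> J \<Longrightarrow> x - y \<in> J"
proof -
  show *: "x \<in> J \<Longrightarrow> x \<in> R" "0 \<in> J" "x \<in> J \<Longrightarrow> y \<in> J \<Longrightarrow> x + y \<in> J"
    and **: "r \<in> R \<Longrightarrow> x \<in> J \<Longrightarrow> r * x \<in> J" for r x y
    using assms by (auto simp: ideal_in_def)
  show ***: "x \<in> J \<Longrightarrow> - x \<in> J" for x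
    using **[of "- 1" x] by simp
  show "x \<in> J \<Longrightarrow> y \<in> J \<Longrightarrow> x - y \<in> J"
    using *(3)[of x "- y"] ***[of y] by simp
qed

lemma ideal_in_sum:
  assumes "ideal_in J" "\<And>x. x \<in> X \<Longrightarrow> f x \<in> J"
  shows "sum f X \<in> J"
  using assms(2) by (induction X rule: infinite_finite_induct) (auto intro: ideal_inD[OF assms(1)])

lemma prod_mem: "(\<And>x. x \<in> X \<Longrightarrow> f x \<in> R) \<Longrightarrow> prod f X \<in> R"
  by (induction X rule: infinite_finite_induct) auto

definition adjoin :: "'a set \<Rightarrow> 'a \<Rightarrow> 'a set" where
  "adjoin J a = {j + a * r | j r. j \<in> J \<and> r \<in> R}"

definition nzd_mod :: "'a set \<Rightarrow> 'a \<Rightarrow> bool" where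
  "nzd_mod J a \<longleftrightarrow> (\<forall>x\<in>R. a * x \<in> J \<longrightarrow> x \<in> J)"

definition colon :: "'a set \<Rightarrow> 'a \<Rightarrow> 'a set" where
  "colon J a = {x \<in> R. a * x \<in> J}"

text \<open>Regularity on R/J without properness of the quotient. Zero modules are harmless in this
  form, so unit ideals and empty products need no exclusion in the inductions below.\<close>

fun wreg :: "'a set \<Rightarrow> 'a list \<Rightarrow> bool" where
  "wreg J [] \<longleftrightarrow> True"
| "wreg J (a # as) \<longleftrightarrow> nzd_mod J a \<and> wreg (adjoin J a) as"

fun adjoin_list :: "'a set \<Rightarrow> 'a list \<Rightarrow> 'a set" where
  "adjoin_list J [] = J"
| "adjoin_list J (a # as) = adjoin_list (adjoin J a) as"

lemma nzd_modD: "nzd_mod J a \<Longrightarrow> a * x \<in> J \<Longrightarrow> x \<in> R \<Longrightarrow> x \<in> J"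
  by (auto simp: nzd_mod_def)

lemma adjoinI: "j \<in> J \<Longrightarrow> r \<in> R \<Longrightarrow> j + a * r \<in> adjoin J a"
  by (auto simp: adjoin_def)

lemma adjoinI': "x - a * r \<in> J \<Longrightarrow> r \<in> R \<Longrightarrow> x \<in> adjoin J a"
  using adjoinI[of "x - a * r" J r a] by simp

lemma adjoinE:
  assumes "x \<in> adjoin J a"
  obtains j r where "x = j + a * r" "j \<in> J" "r \<in> R"
  using assms by (auto simp: adjoin_def)

lemma ideal_in_adjoin:
  assumes "ideal_in J" "a \<in> R"
  shows "ideal_in (adjoin J a)"
proof -
  note J = ideal_inD[OF assms(1)]
  have "x + y \<in> adjoin J a" if "x \<in> adjoin J a" "y \<in> adjoin J a" for x y
  proof -
    from that obtain j r j' r' where "x = j + a * r" "y = j' + a * r'" "j \<in> J" "j' \<in> J" "r \<in> R" "r' \<in> R"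
      by (auto elim!: adjoinE)
    then show ?thesis
      by (intro adjoinI'[of _ _ "r + r'"]) (auto simp: algebra_simps J)
  qed
  moreover have "s * x \<in> adjoin J a" if "x \<in> adjoin J a" "s \<in> R" for x s
  proof -
    from that obtain j r where "x = j + a * r" "j \<in> J" "r \<in> R"
      by (auto elim!: adjoinE)
    with that show ?thesis
      by (intro adjoinI'[of _ _ "s * r"]) (auto simp: distrib_left mult.left_commute J)
  qed
  moreover have "0 \<in> adjoin J a"
    using adjoinI[of 0 J 0 a] by (simp add: J)
  ultimately show ?thesis
    using assms(2) by (auto simp: ideal_in_def J elim!: adjoinE)
qed

lemma subset_adjoin: "J \<subseteq> adjoin J a"
  using adjoinI[of _ J 0 a] by auto

lemma adjoin_commute: "adjoin (adjoin J a) b = adjoin (adjoin J b) a"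
proof -
  have "adjoin (adjoin J a) b \<subseteq> adjoin (adjoin J b) a" for a b
  proof
    fix x assume "x \<in> adjoin (adjoin J a) b"
    then obtain j r s where "x = j + a * r + b * s" "j \<in> J" "r \<in> R" "s \<in> R"
      by (auto elim!: adjoinE)
    then show "x \<in> adjoin (adjoin J b) a"
      by (intro adjoinI'[of _ _ r] adjoinI'[of _ _ s]) (auto simp: algebra_simps)
  qed
  then show ?thesis by blast
qed

text \<open>Only the class of the element modulo J matters; this later replaces an elementary
  symmetric polynomial by a product of variables.\<close>

lemma adjoin_cong:
  assumes "ideal_in J" "a - b \<in> J"
  shows "adjoin J a = adjoin J b"
proof -
  note J = ideal_inD[OF assms(1)]
  have "adjoin J a \<subseteq> adjoin J b" if "a - b \<in> J" for a b
  proof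
    fix x assume "x \<in> adjoin J a"
    then obtain j r where x: "x = j + a * r" "j \<in> J" "r \<in> R"
      by (auto elim!: adjoinE)
    then have "x - b * r = j + r * (a - b)"
      by (simp add: algebra_simps)
    also have "\<dots> \<in> J" using x that by (auto intro: J)
    finally show "x \<in> adjoin J b"
      using x by (intro adjoinI'[of _ _ r])
  qed
  from this[of a b] this[of b a] assms(2) J(5)[of "a - b"] show ?thesis by auto
qed

lemma nzd_mod_cong:
  assumes "ideal_in J" "a - b \<in> J"
  shows "nzd_mod J a \<longleftrightarrow> nzd_mod J b"
proof -
  note J = ideal_inD[OF assms(1)]
  have "a * x \<in> J \<longleftrightarrow> b * x \<in> J" if "x \<in> R" for x
  proof -
    have "(a - b) * x \<in> J" using J(4)[OF that assms(2)] by (simp add: mult.commute)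
    with J(6)[of "a * x" "(a - b) * x"] J(3)[of "b * x" "(a - b) * x"] show ?thesis
      by (auto simp: algebra_simps)
  qed
  then show ?thesis by (simp add: nzd_mod_def)
qed

text \<open>Elements can be adjoined in any order. This reconciles the accumulating recursion with
  that of \<open>list_smult\<close>, which adds the first element last.\<close>

lemma adjoin_list_adjoin: "adjoin_list (adjoin J b) as = adjoin (adjoin_list J as) b"
proof (induction as arbitrary: J)
  case (Cons a as)
  show ?case using Cons[of "adjoin J a"] by (simp add: adjoin_commute[of J b a])
qed simp

lemma ideal_in_adjoin_list: "ideal_in J \<Longrightarrow> set as \<subseteq> R \<Longrightarrow> ideal_in (adjoin_list J as)"
  by (induction as arbitrary: J) (simp_all add: ideal_in_adjoin)

lemma adjoin_list_subset:
  assumes "ideal_in J'" "J \<subseteq> J'" "set as \<subseteq> J'"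
  shows "adjoin_list J as \<subseteq> J'"
  using assms
proof (induction as arbitrary: J)
  case (Cons a as)
  then have "adjoin J a \<subseteq> J'"
    using ideal_inD(4)[OF Cons.prems(1), of _ a]
    by (auto elim!: adjoinE intro!: ideal_inD(3)[OF Cons.prems(1)] simp: mult.commute)
  with Cons show ?case by auto
qed auto

lemma wreg_iff:
  "wreg J as \<longleftrightarrow> (\<forall>i<length as. nzd_mod (adjoin_list J (take i as)) (as ! i))"
  by (induction as arbitrary: J) (simp_all add: All_less_Suc2)

text \<open>The half of the permutability of regular sequences that holds without a local or graded
  hypothesis. If b x = j + c v, then c v vanishes modulo J + bR, so v = j' + b v', and b cancels
  from b (x - c v') \<in> J.\<close>

lemma nzd_mod_swap:
  assumes "ideal_in J" "b \<in> R" "c \<in> R" "nzd_mod J b" "nzd_mod (adjoin J b) c"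
  shows "nzd_mod (adjoin J c) b"
  unfolding nzd_mod_def
proof safe
  note J = ideal_inD[OF assms(1)]
  fix x assume x: "x \<in> R" "b * x \<in> adjoin J c"
  then obtain j v where v: "b * x = j + c * v" "j \<in> J" "v \<in> R"
    by (auto elim!: adjoinE)
  from v have "c * v = - j + b * x" by (simp add: algebra_simps)
  also have "\<dots> \<in> adjoin J b"
    using v x by (intro adjoinI J(5))
  finally have "c * v \<in> adjoin J b" .
  then have "v \<in> adjoin J b"
    using assms(5) v by (auto simp: nzd_mod_def)
  then obtain j' v' where v': "v = j' + b * v'" "j' \<in> J" "v' \<in> R"
    by (auto elim!: adjoinE)
  have "b * (x - c * v') = j + c * j'"
    using v(1) v'(1) by (simp add: algebra_simps)
  also have "\<dots> \<in> J" using v v' assms by (auto intro!: J)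
  finally have "x - c * v' \<in> J"
    using assms(4) x v' assms(3) by (auto simp: nzd_mod_def)
  then show "x \<in> adjoin J c" using v' by (rule_tac adjoinI')
qed

lemma nzd_mod_mult:
  assumes "a \<in> R" "b \<in> R" "nzd_mod J a" "nzd_mod J b"
  shows "nzd_mod J (a * b)"
  unfolding nzd_mod_def
proof safe
  fix x assume "x \<in> R" "a * b * x \<in> J"
  with assms show "x \<in> J"
    using nzd_modD[of J a "b * x"] nzd_modD[of J b x] by (simp add: mult.assoc)
qed

text \<open>As a is a nonzerodivisor on R/J, multiplication by a gives an exact sequence 0 -> R/(J +
  bR) -> R/(J + abR) -> R/(J + aR) -> 0, and regularity passes to the middle term. The exchange
  lemma \<open>nzd_mod_swap\<close> keeps a and b nonzerodivisors after the head of the sequence is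
  adjoined.\<close>

lemma wreg_adjoin_mult:
  assumes "ideal_in J" "a \<in> R" "b \<in> R" "nzd_mod J a" "nzd_mod J b" "set cs \<subseteq> R"
    "wreg (adjoin J a) cs" "wreg (adjoin J b) cs"
  shows "wreg (adjoin J (a * b)) cs"
  using assms
proof (induction cs arbitrary: J)
  case (Cons c cs)
  note J = ideal_inD[OF Cons.prems(1)]
  have c: "c \<in> R" using Cons.prems by simp
  have "nzd_mod (adjoin J (a * b)) c"
    unfolding nzd_mod_def
  proof safe
    fix x assume x: "x \<in> R" "c * x \<in> adjoin J (a * b)"
    then obtain j v where v: "c * x = j + a * b * v" "j \<in> J" "v \<in> R"
      by (auto elim!: adjoinE)
    then have "c * x \<in> adjoin J a"
      using Cons.prems by (intro adjoinI'[of _ _ "b * v"]) (auto simp: algebra_simps)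
    then have "x \<in> adjoin J a" using Cons.prems(7) x(1) nzd_modD[of "adjoin J a" c] by simp
    then obtain j' y where y: "x = j' + a * y" "j' \<in> J" "y \<in> R"
      by (auto elim!: adjoinE)
    have "a * (c * y - b * v) = j - c * j'"
      using v(1) y(1) by (simp add: algebra_simps)
    also have "\<dots> \<in> J" using v y c by (auto intro!: J)
    finally have "c * y - b * v \<in> J"
      using v y c Cons.prems(3) by (rule_tac nzd_modD[OF Cons.prems(4)]) simp_all
    then have "c * y \<in> adjoin J b" using v by (rule_tac adjoinI')
    then have "y \<in> adjoin J b" using Cons.prems(8) y(3) nzd_modD[of "adjoin J b" c] by simp
    then obtain j'' z where z: "y = j'' + b * z" "j'' \<in> J" "z \<in> R"
      by (auto elim!: adjoinE)
    show "x \<in> adjoin J (a * b)"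
      using y z Cons.prems by (intro adjoinI'[of _ _ z]) (auto simp: algebra_simps intro!: J)
  qed
  moreover have "wreg (adjoin (adjoin J c) (a * b)) cs"
  proof (rule Cons.IH)
    show "nzd_mod (adjoin J c) a" "nzd_mod (adjoin J c) b"
      using Cons.prems c by (auto intro: nzd_mod_swap[of J])
    show "wreg (adjoin (adjoin J c) a) cs" "wreg (adjoin (adjoin J c) b) cs"
      using Cons.prems by (simp_all add: adjoin_commute[of J c])
  qed (use Cons.prems c in \<open>auto intro: ideal_in_adjoin\<close>)
  ultimately show ?case by (simp add: adjoin_commute[of J c])
qed auto

lemma wreg_mult:
  assumes "ideal_in J" "a \<in> R" "b \<in> R" "set cs \<subseteq> R" "wreg J (a # cs)" "wreg J (b # cs)"
  shows "wreg J (a * b # cs)"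
  using assms by (auto intro: nzd_mod_mult wreg_adjoin_mult)

lemma wreg_carrier: "set as \<subseteq> R \<Longrightarrow> wreg R as"
proof (induction as)
  case (Cons a as)
  then have "adjoin R a = R" using subset_adjoin[of R a] by (auto elim!: adjoinE)
  with Cons show ?case by (auto simp: nzd_mod_def)
qed auto

lemma adjoin_one:
  assumes "ideal_in J"
  shows "adjoin J 1 = R"
proof -
  have "x \<in> adjoin J 1" if "x \<in> R" for x
    using adjoinI[OF ideal_inD(2)[OF assms] that, of 1] by simp
  then show ?thesis by (auto elim!: adjoinE simp: ideal_inD[OF assms])
qed

lemma wreg_prod:
  assumes "ideal_in J" "finite A" "\<And>i. i \<in> A \<Longrightarrow> g i \<in> R" "set cs \<subseteq> R"
    "\<And>i. i \<in> A \<Longrightarrow> wreg J (g i # cs)"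
  shows "wreg J (prod g A # cs)"
  using assms(2,3,5)
proof (induction A rule: finite_induct)
  case empty
  \<comment> \<open>The empty product is 1, and adjoining 1 yields R, modulo which every sequence is
    weakly regular.\<close>
  show ?case using assms by (auto simp: adjoin_one wreg_carrier nzd_mod_def)
next
  case (insert i A)
  have "prod g A \<in> R" using insert by (intro prod_mem) auto
  with insert show ?case using wreg_mult[of J "g i" "prod g A" cs] assms(1,4) by simp
qed

lemma wreg_power:
  assumes "ideal_in J" "a \<in> R" "set cs \<subseteq> R" "wreg J (a # cs)"
  shows "wreg J (a ^ k # cs)"
proof (induction k)
  case 0
  show ?case using assms by (auto simp: adjoin_one wreg_carrier nzd_mod_def)
next
  case (Suc k)
  then show ?case using wreg_mult[OF assms(1,2) _ assms(3,4), of "a ^ k"] assms(2) by simp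
qed

text \<open>Powers push elements of the maximal ideal into high degree, which the upper bound
  exploits. The head is handled as a repeated product, the tail by induction.\<close>

lemma wreg_map_power:
  assumes "ideal_in J" "set as \<subseteq> R" "wreg J as"
  shows "wreg J (map (\<lambda>a. a ^ k) as)"
  using assms
proof (induction as arbitrary: J)
  case (Cons a as)
  then have "wreg J (a ^ k # as)" using wreg_power[of J a as k] by simp
  with Cons show ?case by (simp add: ideal_in_adjoin)
qed auto

text \<open>Regularity passes to the middle term of \<open>0 \<rightarrow> R/(J : x) \<rightarrow> R/J \<rightarrow> R/(J + x) \<rightarrow> 0\<close>.\<close>

lemma wreg_exact:
  assumes "ideal_in J" "x \<in> R" "set fs \<subseteq> R" "wreg (colon J x) fs" "wreg (adjoin J x) fs"
  shows "wreg J fs"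
  using assms
proof (induction fs arbitrary: J)
  case (Cons f fs)
  note J = ideal_inD[OF Cons.prems(1)]
  have f: "f \<in> R" using Cons.prems by simp
  have "nzd_mod J f"
    unfolding nzd_mod_def
  proof safe
    fix y assume y: "y \<in> R" "f * y \<in> J"
    then have "y \<in> adjoin J x"
      using Cons.prems subset_adjoin[of J x] unfolding wreg.simps nzd_mod_def by blast
    then obtain j z where z: "y = j + x * z" "j \<in> J" "z \<in> R" by (auto elim!: adjoinE)
    have "x * (f * z) = f * y - f * j" using z by (simp add: algebra_simps)
    also have "\<dots> \<in> J" using y z f by (auto intro!: J)
    finally have "f * z \<in> colon J x" using f z by (auto simp: colon_def)
    then have "z \<in> colon J x" using Cons.prems z by (auto simp: nzd_mod_def)
    then show "y \<in> J" using z by (auto simp: colon_def intro: J)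
  qed
  \<comment> \<open>Colon by x and adjunction of f commute because f is regular modulo J + xR: from
    x z = j + f r this gives r \<in> J + xR. So the hypotheses pass to J + fR.\<close>
  moreover have "colon (adjoin J f) x = adjoin (colon J x) f"
  proof
    show "adjoin (colon J x) f \<subseteq> colon (adjoin J f) x"
    proof
      fix z assume "z \<in> adjoin (colon J x) f"
      then obtain z' r where z: "z = z' + f * r" "z' \<in> colon J x" "r \<in> R" by (auto elim!: adjoinE)
      then show "z \<in> colon (adjoin J f) x"
        using f Cons.prems(2)
        by (auto simp: colon_def algebra_simps intro!: adjoinI'[of _ _ "x * r"])
    qed
    show "colon (adjoin J f) x \<subseteq> adjoin (colon J x) f"
    proof
      fix z assume "z \<in> colon (adjoin J f) x"
      then obtain j r where z: "z \<in> R" "x * z = j + f * r" "j \<in> J" "r \<in> R"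
        by (auto simp: colon_def elim!: adjoinE)
      have "f * r = - j + x * z" using z by simp
      also have "\<dots> \<in> adjoin J x" using z by (intro adjoinI J(5))
      finally have "f * r \<in> adjoin J x" .
      then have "r \<in> adjoin J x" using Cons.prems z by (auto simp: nzd_mod_def)
      then obtain j' r' where r: "r = j' + x * r'" "j' \<in> J" "r' \<in> R" by (auto elim!: adjoinE)
      have "x * (z - f * r') = j + f * j'" using z r by (simp add: algebra_simps)
      also have "\<dots> \<in> J" using z r f by (auto intro!: J)
      finally show "z \<in> adjoin (colon J x) f"
        using z r f by (intro adjoinI'[of _ _ r']) (auto simp: colon_def)
    qed
  qed
  ultimately show ?case
    using Cons.prems Cons.IH[of "adjoin J f"]
    by (simp add: ideal_in_adjoin adjoin_commute[of J f x])
qed auto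

lemma list_monom_mem: "set as \<subseteq> R \<Longrightarrow> list_monom as ks \<in> R"
  by (induction as ks rule: list_monom.induct) auto

text \<open>
  The induction peels off the lowest power of the first element occurring in the relation: it can be
  cancelled, and what remains is, modulo the first element, a relation between the other ones.
\<close>

lemma wreg_relation:
  assumes "ideal_in J" "set as \<subseteq> R" "wreg J as" "w \<in> R"
    and "finite X" "\<And>\<alpha>. \<alpha> \<in> X \<Longrightarrow> length \<alpha> = length as" "X \<noteq> {}"
    and "\<And>\<alpha>. \<alpha> \<in> X \<Longrightarrow> c \<alpha> \<in> R \<and> (\<exists>v\<in>R. v * c \<alpha> = 1)"
    and "(\<Sum>\<alpha>\<in>X. c \<alpha> * list_monom as \<alpha>) * w \<in> J"
  shows "w \<in> adjoin_list J as"
  using assms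
proof (induction as arbitrary: J X c)
  \<comment> \<open>Only the empty exponent vector remains, so the relation is a unit times
    w.\<close>
  case Nil
  then have "X \<subseteq> {[]}" by fastforce
  with Nil.prems have X: "X = {[]}" by blast
  then obtain v where v: "v \<in> R" "v * c [] = 1" using Nil.prems by auto
  have "v * (c [] * w) \<in> J" using Nil.prems X v by (auto intro: ideal_inD)
  moreover have "v * (c [] * w) = w" using v by (simp flip: mult.assoc)
  ultimately show ?case by simp
next
  case (Cons a as)
  note J = ideal_inD[OF Cons.prems(1)]
  have a: "a \<in> R" "set as \<subseteq> R" using Cons.prems by auto
  define m where "m = Min (hd ` X)"
  define X' where "X' = {\<beta>. m # \<beta> \<in> X}"
  have m: "m \<le> hd \<alpha>" if "\<alpha> \<in> X" for \<alpha>
    using that Cons.prems by (auto simp: m_def)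
  have ne: "\<alpha> = hd \<alpha> # tl \<alpha>" if "\<alpha> \<in> X" for \<alpha>
    using Cons.prems(6)[OF that] by (cases \<alpha>) auto
  have "m \<in> hd ` X" unfolding m_def using Cons.prems by (intro Min_in) auto
  then obtain \<alpha> where "\<alpha> \<in> X" "hd \<alpha> = m" by blast
  with ne[of \<alpha>] have "tl \<alpha> \<in> X'" by (simp add: X'_def)
  then have X'ne: "X' \<noteq> {}" by blast
  have img: "(#) m ` X' = {\<alpha>\<in>X. hd \<alpha> = m}"
  proof safe
    fix \<alpha> assume "\<alpha> \<in> X" "m = hd \<alpha>"
    with ne[of \<alpha>] show "\<alpha> \<in> (#) (hd \<alpha>) ` X'"
      by (intro image_eqI[of _ _ "tl \<alpha>"]) (simp_all add: X'_def)
  qed (auto simp: X'_def)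
  have fin: "finite X'"
    using finite_imageD[of "(#) m" X'] img Cons.prems by (auto simp: inj_on_def)
  \<comment> \<open>After splitting off \<open>a ^ m\<close>, the terms with least exponent m of a
    form p, and all others form a q. The relation thus reads
    \<open>a ^ m * ((p + a * q) * w) \<in> J\<close>.\<close>
  define p where "p = (\<Sum>\<beta>\<in>X'. c (m # \<beta>) * list_monom as \<beta>)"
  define q where "q = (\<Sum>\<alpha>\<in>{\<alpha>\<in>X. hd \<alpha> \<noteq> m}. c \<alpha> * (a ^ (hd \<alpha> - Suc m) * list_monom as (tl \<alpha>)))"
  have pR: "p \<in> R" unfolding p_def
    using Cons.prems a by (intro sum_mem mult_mem list_monom_mem) (auto simp: X'_def)
  have qR: "q \<in> R" unfolding q_def
    using Cons.prems a by (intro sum_mem mult_mem list_monom_mem) auto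
  have "(\<Sum>\<alpha>\<in>X. c \<alpha> * list_monom (a # as) \<alpha>)
      = (\<Sum>\<alpha>\<in>{\<alpha>\<in>X. hd \<alpha> = m}. c \<alpha> * list_monom (a # as) \<alpha>)
      + (\<Sum>\<alpha>\<in>{\<alpha>\<in>X. hd \<alpha> \<noteq> m}. c \<alpha> * list_monom (a # as) \<alpha>)"
    using Cons.prems by (subst sum.union_disjoint[symmetric]) (auto intro!: sum.cong)
  also have "(\<Sum>\<alpha>\<in>{\<alpha>\<in>X. hd \<alpha> = m}. c \<alpha> * list_monom (a # as) \<alpha>) = a ^ m * p"
    unfolding img[symmetric] p_def
    by (subst sum.reindex) (auto simp: inj_on_def sum_distrib_left mult_ac)
  also have "(\<Sum>\<alpha>\<in>{\<alpha>\<in>X. hd \<alpha> \<noteq> m}. c \<alpha> * list_monom (a # as) \<alpha>) = a ^ m * (a * q)"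
    unfolding q_def sum_distrib_left
  proof (intro sum.cong refl)
    fix \<alpha> assume "\<alpha> \<in> {\<alpha>\<in>X. hd \<alpha> \<noteq> m}"
    then have "\<alpha> \<in> X" "m < hd \<alpha>" using m[of \<alpha>] by auto
    then obtain l where l: "hd \<alpha> = Suc (m + l)" using less_imp_Suc_add by blast
    have "list_monom (a # as) \<alpha> = a ^ hd \<alpha> * list_monom as (tl \<alpha>)"
      using ne[OF \<open>\<alpha> \<in> X\<close>] list_monom.simps(1)[of a as "hd \<alpha>" "tl \<alpha>"] by simp
    then show "c \<alpha> * list_monom (a # as) \<alpha>
        = a ^ m * (a * (c \<alpha> * (a ^ (hd \<alpha> - Suc m) * list_monom as (tl \<alpha>))))"
      by (simp add: l power_add mult_ac)
  qed
  finally have "(\<Sum>\<alpha>\<in>X. c \<alpha> * list_monom (a # as) \<alpha>) * w = a ^ m * ((p + a * q) * w)"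
    by (simp only: algebra_simps)
  with Cons.prems(9) have "a ^ m * ((p + a * q) * w) \<in> J" by simp
  moreover have "y \<in> J" if "a ^ k * y \<in> J" "y \<in> R" for k y
    using that(1)
  proof (induction k)
    case (Suc k)
    then show ?case using Cons.prems(3) a that(2) nzd_modD[of J a "a ^ k * y"] by (simp add: mult.assoc)
  qed auto
  ultimately have "(p + a * q) * w \<in> J" using pR qR a Cons.prems(4) by simp
  then have "p * w \<in> adjoin J a"
    using qR Cons.prems(4) by (intro adjoinI'[of _ _ "- q * w"]) (simp_all add: algebra_simps)
  then have "(\<Sum>\<beta>\<in>X'. c (m # \<beta>) * list_monom as \<beta>) * w \<in> adjoin J a"
    by (simp add: p_def)
  moreover have "length \<beta> = length as" if "\<beta> \<in> X'" for \<beta>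
    using that Cons.prems(6)[of "m # \<beta>"] by (simp add: X'_def)
  moreover have "c (m # \<beta>) \<in> R \<and> (\<exists>v\<in>R. v * c (m # \<beta>) = 1)" if "\<beta> \<in> X'" for \<beta>
    using that Cons.prems(8)[of "m # \<beta>"] by (simp add: X'_def)
  moreover have "ideal_in (adjoin J a)" "wreg (adjoin J a) as"
    using Cons.prems(1,3) a by (simp_all add: ideal_in_adjoin)
  ultimately have "w \<in> adjoin_list (adjoin J a) as"
    using fin X'ne a(2) Cons.prems(4) by (intro Cons.IH[where X = X' and c = "\<lambda>\<beta>. c (m # \<beta>)"])
  then show ?case by simp
qed

end

section \<open>Linear systems with more unknowns than equations\<close>

lemma homogeneous_system:
  fixes A :: "'x \<Rightarrow> 'y \<Rightarrow> 'k::field"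
  assumes "finite Y" "finite X" "card Y < card X"
  shows "\<exists>c. (\<exists>x\<in>X. c x \<noteq> 0) \<and> (\<forall>y\<in>Y. (\<Sum>x\<in>X. c x * A x y) = 0)"
  using assms
proof (induction Y arbitrary: X A)
  case empty
  then obtain x where "x \<in> X" by (auto simp: card_gt_0_iff)
  then show ?case by (intro exI[of _ "\<lambda>_. 1"]) auto
next
  case (insert y Y)
  show ?case
  proof (cases "\<forall>x\<in>X. A x y = 0")
    case True
    with insert.IH[of X A] insert.prems insert.hyps show ?thesis by auto
  next
    case False
    then obtain z where z: "z \<in> X" "A z y \<noteq> 0" by auto
    \<comment> \<open>Gaussian elimination: z is the pivot for the equation y, B is the system after
      substituting for the unknown at z, and \<open>c'\<close> extends a solution of B so that
      equation y holds too.\<close>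
    define B where "B x v = A x v - A x y / A z y * A z v" for x v
    have "card Y < card (X - {z})" using insert z by simp
    from insert.IH[OF _ this, of B] insert.prems obtain c
      where c: "\<exists>x\<in>X - {z}. c x \<noteq> 0" "\<And>v. v \<in> Y \<Longrightarrow> (\<Sum>x\<in>X - {z}. c x * B x v) = 0"
      by auto
    define c' where "c' = c(z := - (\<Sum>x\<in>X - {z}. c x * A x y / A z y))"
    have eq: "(\<Sum>x\<in>X. c' x * A x v) = (\<Sum>x\<in>X - {z}. c x * B x v)" for v
    proof -
      have "(\<Sum>x\<in>X. c' x * A x v) = c' z * A z v + (\<Sum>x\<in>X - {z}. c' x * A x v)"
        using insert.prems z by (simp add: sum.remove)
      also have "(\<Sum>x\<in>X - {z}. c' x * A x v) = (\<Sum>x\<in>X - {z}. c x * A x v)"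
        by (intro sum.cong) (auto simp: c'_def)
      also have "c' z * A z v + \<dots> = (\<Sum>x\<in>X - {z}. c x * B x v)"
        by (simp add: c'_def B_def right_diff_distrib sum_subtractf sum_distrib_left mult_ac)
      finally show ?thesis .
    qed
    have "B x y = 0" for x using z by (simp add: B_def)
    with c eq have "\<forall>v\<in>insert y Y. (\<Sum>x\<in>X. c' x * A x v) = 0" by simp
    moreover have "\<exists>x\<in>X. c' x \<noteq> 0" using c by (auto simp: c'_def)
    ultimately show ?thesis by blast
  qed
qed

section \<open>Polynomials with prescribed terms\<close>

lemma mpoly_ring_simps [simp]:
  "mult (mpoly_ring n) = (*)" "one (mpoly_ring n) = 1" "zero (mpoly_ring n) = 0" "add (mpoly_ring n) = (+)"
  by (simp_all add: mpoly_ring_def)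

lemma mem_mpoly_ring_iff:
  "p \<in> carrier (mpoly_ring n) \<longleftrightarrow> (\<forall>a\<in>Poly_Mapping.keys p. Poly_Mapping.keys a \<subseteq> {1..n})"
  by (simp add: mpoly_ring_def)

interpretation mpoly: comm_subring "carrier (mpoly_ring n :: 'k::field mpoly ring)" for n
proof
  interpret cring "mpoly_ring n :: 'k mpoly ring" by (rule mpoly_ring_cring)
  fix x y :: "'k mpoly"
  assume x: "x \<in> carrier (mpoly_ring n)"
  then show "- x \<in> carrier (mpoly_ring n)" by (simp add: mem_mpoly_ring_iff)
  assume y: "y \<in> carrier (mpoly_ring n)"
  from add.m_closed[OF x y] m_closed[OF x y]
  show "x + y \<in> carrier (mpoly_ring n)" "x * y \<in> carrier (mpoly_ring n)" by simp_all
qed (simp_all add: mem_mpoly_ring_iff)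

lemma keys_plus_nat: "Poly_Mapping.keys (a + b :: 'x \<Rightarrow>\<^sub>0 nat) = Poly_Mapping.keys a \<union> Poly_Mapping.keys b"
  by (auto simp: in_keys_iff lookup_add)

lemma sum_single_eq: "(\<Sum>a\<in>Poly_Mapping.keys p. Poly_Mapping.single a (Poly_Mapping.lookup p a)) = p"
proof (rule poly_mapping_eqI)
  fix b
  have "Poly_Mapping.lookup (\<Sum>a\<in>Poly_Mapping.keys p. Poly_Mapping.single a (Poly_Mapping.lookup p a)) b
      = (\<Sum>a\<in>Poly_Mapping.keys p. if a = b then Poly_Mapping.lookup p a else 0)"
    unfolding lookup_sum by (intro sum.cong) (auto simp: lookup_single when_def)
  also have "\<dots> = Poly_Mapping.lookup p b" by (simp add: in_keys_iff)
  finally show "Poly_Mapping.lookup (\<Sum>a\<in>Poly_Mapping.keys p. Poly_Mapping.single a (Poly_Mapping.lookup p a)) b = Poly_Mapping.lookup p b" .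
qed

lemma lookup_mon_mult: "Poly_Mapping.lookup (mon b * p) (b + a) = Poly_Mapping.lookup (p :: 'k::field mpoly) a"
proof -
  have "mon b * p = (\<Sum>c\<in>Poly_Mapping.keys p. Poly_Mapping.single (b + c) (Poly_Mapping.lookup p c))"
    by (subst sum_single_eq[of p, symmetric])
       (simp add: mon_def sum_distrib_left mult_single)
  then have "Poly_Mapping.lookup (mon b * p) (b + a) = (\<Sum>c\<in>Poly_Mapping.keys p. if c = a then Poly_Mapping.lookup p c else 0)"
    by (simp only: lookup_sum) (intro sum.cong, auto simp: lookup_single when_def)
  also have "\<dots> = Poly_Mapping.lookup p a" by (simp add: in_keys_iff)
  finally show ?thesis .
qed

lemma keys_mult_mem:
  assumes "c \<in> Poly_Mapping.keys (p * q)"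
  obtains a b where "c = a + b" "a \<in> Poly_Mapping.keys p" "b \<in> Poly_Mapping.keys q"
  using assms keys_mult[of p q] by blast

lemma keys_mon_mult: "Poly_Mapping.keys (mon b * p) = (+) b ` Poly_Mapping.keys p"
proof
  show "Poly_Mapping.keys (mon b * p) \<subseteq> (+) b ` Poly_Mapping.keys p"
    by (auto elim!: keys_mult_mem simp: mon_def)
qed (auto simp: in_keys_iff lookup_mon_mult)

definition restrict_terms :: "('x \<Rightarrow> bool) \<Rightarrow> ('x \<Rightarrow>\<^sub>0 'k) \<Rightarrow> ('x \<Rightarrow>\<^sub>0 'k::zero)" where
  "restrict_terms Q = Poly_Mapping.mapp (\<lambda>a c. if Q a then c else 0)"

lemma lookup_restrict_terms: "Poly_Mapping.lookup (restrict_terms Q p) a = (if Q a then Poly_Mapping.lookup p a else 0)"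
  by (auto simp: restrict_terms_def lookup_mapp when_def in_keys_iff)

lemma keys_restrict_terms: "Poly_Mapping.keys (restrict_terms Q p) = {a \<in> Poly_Mapping.keys p. Q a}"
  by (auto simp: in_keys_iff lookup_restrict_terms split: if_splits)

lemma restrict_terms_add: "restrict_terms Q (p + q) = restrict_terms Q p + restrict_terms Q q"
  by (rule poly_mapping_eqI) (simp add: lookup_restrict_terms lookup_add)

lemma restrict_terms_split: "restrict_terms Q p + restrict_terms (\<lambda>a. \<not> Q a) p = p"
  by (rule poly_mapping_eqI) (simp add: lookup_restrict_terms lookup_add)

lemma restrict_terms_id: "(\<And>a. a \<in> Poly_Mapping.keys p \<Longrightarrow> Q a) \<Longrightarrow> restrict_terms Q p = p"
  by (rule poly_mapping_eqI) (auto simp: lookup_restrict_terms in_keys_iff)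

lemma restrict_terms_zero: "(\<And>a. a \<in> Poly_Mapping.keys p \<Longrightarrow> \<not> Q a) \<Longrightarrow> restrict_terms Q p = 0"
  by (rule poly_mapping_eqI) (auto simp: lookup_restrict_terms in_keys_iff)

lemma restrict_terms_mem:
  "p \<in> carrier (mpoly_ring n) \<Longrightarrow> restrict_terms Q p \<in> carrier (mpoly_ring n)"
  by (auto simp: mem_mpoly_ring_iff keys_restrict_terms)

text \<open>Monomial ideals are encoded by predicates on exponent vectors: adjoining a variable and
  taking the colon by it become operations on predicates, and up-closed predicates give
  ideals.\<close>

definition mono_span :: "nat \<Rightarrow> ((nat \<Rightarrow>\<^sub>0 nat) \<Rightarrow> bool) \<Rightarrow> 'k::field mpoly set" where
  "mono_span n Q = {p \<in> carrier (mpoly_ring n). \<forall>a\<in>Poly_Mapping.keys p. Q a}"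

definition up_closed :: "('x::plus \<Rightarrow> bool) \<Rightarrow> bool" where
  "up_closed Q \<longleftrightarrow> (\<forall>a b. Q a \<longrightarrow> Q (a + b))"

lemma ideal_mono_span:
  assumes "up_closed Q"
  shows "mpoly.ideal_in n (mono_span n Q :: 'k::field mpoly set)"
  unfolding mpoly.ideal_in_def
proof (intro conjI ballI)
  fix x y :: "'k mpoly" assume "x \<in> mono_span n Q" "y \<in> mono_span n Q"
  then show "x + y \<in> mono_span n Q"
    using keys_add[of x y] by (auto simp: mono_span_def)
next
  fix r x :: "'k mpoly" assume "r \<in> carrier (mpoly_ring n)" "x \<in> mono_span n Q"
  then show "r * x \<in> mono_span n Q"
    using assms
    by (auto simp: mono_span_def up_closed_def elim!: keys_mult_mem) (metis add.commute)
qed (auto simp: mono_span_def)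

lemma mono_span_cong:
  "(\<And>a. Poly_Mapping.keys a \<subseteq> {1..n} \<Longrightarrow> Q a \<longleftrightarrow> Q' a) \<Longrightarrow> mono_span n Q = mono_span n Q'"
  by (auto simp: mono_span_def mem_mpoly_ring_iff)

lemma mon_mem: "Poly_Mapping.keys a \<subseteq> {1..n} \<Longrightarrow> mon a \<in> carrier (mpoly_ring n)"
  by (simp add: mem_mpoly_ring_iff mon_def)

lemma var_mem: "i \<in> {1..n} \<Longrightarrow> var i \<in> carrier (mpoly_ring n)"
  by (simp add: var_def mon_mem)

lemma keys_eq_single_plus:
  assumes "i \<in> Poly_Mapping.keys (a :: nat \<Rightarrow>\<^sub>0 nat)"
  shows "a = Poly_Mapping.single i 1 + (a - Poly_Mapping.single i 1)"
  using assms by (intro poly_mapping_eqI) (auto simp: lookup_add lookup_minus lookup_single when_def in_keys_iff)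

lemma adjoin_mono_span_var:
  assumes "up_closed Q" "i \<in> {1..n}"
  shows "mpoly.adjoin n (mono_span n Q) (var i) = (mono_span n (\<lambda>a. Q a \<or> i \<in> Poly_Mapping.keys a) :: 'k::field mpoly set)"
    (is "?L = ?R")
proof
  have "up_closed (\<lambda>a. Q a \<or> i \<in> Poly_Mapping.keys a)"
    using assms(1) by (auto simp: up_closed_def keys_plus_nat)
  note R = mpoly.ideal_inD[OF ideal_mono_span[OF this, where 'k = 'k]]
  show "?L \<subseteq> ?R"
  proof
    fix x :: "'k mpoly" assume "x \<in> ?L"
    then obtain j r where x: "x = j + var i * r" "j \<in> mono_span n Q" "r \<in> carrier (mpoly_ring n)"
      by (auto elim!: mpoly.adjoinE)
    have "j \<in> ?R" using x by (auto simp: mono_span_def)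
    moreover have "var i * r \<in> ?R"
      using x var_mem[OF assms(2), where 'a = 'k]
      by (auto simp: mono_span_def var_def keys_mon_mult keys_plus_nat)
    ultimately show "x \<in> ?R" unfolding x by (rule R(3))
  qed
  show "?R \<subseteq> ?L"
  proof
    fix p assume p: "p \<in> ?R"
    define p2 where "p2 = restrict_terms (\<lambda>a. \<not> Q a) p"
    \<comment> \<open>This is \<open>p2\<close> divided by the variable; the subtraction of
      exponents is exact since i occurs in every exponent vector of \<open>p2\<close>.\<close>
    define q where "q = (\<Sum>a\<in>Poly_Mapping.keys p2. Poly_Mapping.single (a - Poly_Mapping.single i 1) (Poly_Mapping.lookup p2 a))"
    have k2: "i \<in> Poly_Mapping.keys a" "Poly_Mapping.keys a \<subseteq> {1..n}" if "a \<in> Poly_Mapping.keys p2" for a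
      using that p by (auto simp: p2_def keys_restrict_terms mono_span_def mem_mpoly_ring_iff)
    have "var i * q = (\<Sum>a\<in>Poly_Mapping.keys p2. Poly_Mapping.single a (Poly_Mapping.lookup p2 a))"
      unfolding q_def var_def mon_def sum_distrib_left mult_single mult_1_left
      using k2 keys_eq_single_plus by (intro sum.cong) auto
    then have "var i * q = p2" by (simp only: sum_single_eq)
    moreover have "q \<in> carrier (mpoly_ring n)"
      unfolding q_def
    proof (rule mpoly.sum_mem)
      fix a assume "a \<in> Poly_Mapping.keys p2"
      moreover have "Poly_Mapping.keys (a - Poly_Mapping.single i 1) \<subseteq> Poly_Mapping.keys a"
        by (auto simp: in_keys_iff lookup_minus)
      ultimately show "Poly_Mapping.single (a - Poly_Mapping.single i 1) (Poly_Mapping.lookup p2 a) \<in> carrier (mpoly_ring n)"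
        using k2[of a] by (auto simp: mem_mpoly_ring_iff split: if_splits)
    qed
    moreover have "restrict_terms Q p \<in> mono_span n Q"
      using p restrict_terms_mem[of p n Q] by (auto simp: mono_span_def keys_restrict_terms)
    ultimately show "p \<in> ?L"
      using mpoly.adjoinI[of "restrict_terms Q p" "mono_span n Q" q n "var i"] restrict_terms_split[of Q p]
      by (simp add: p2_def)
  qed
qed

lemma colon_mono_span_var:
  assumes "i \<in> {1..n}"
  shows "mpoly.colon n (mono_span n Q) (var i) = mono_span n (\<lambda>a. Q (a + Poly_Mapping.single i 1))"
  using mpoly.mult_mem[OF var_mem[OF assms]]
  by (auto simp: mpoly.colon_def mono_span_def var_def keys_mon_mult add.commute)

lemma nzd_mod_iff_colon: "mpoly.nzd_mod n J a \<longleftrightarrow> mpoly.colon n J a \<subseteq> J"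
  by (auto simp: mpoly.nzd_mod_def mpoly.colon_def)

text \<open>The quotient by \<open>coord_ideal n V\<close> is the polynomial ring in the variables with index in \<open>V\<close>.\<close>

abbreviation coord_ideal :: "nat \<Rightarrow> nat set \<Rightarrow> 'k::field mpoly set" where
  "coord_ideal n V \<equiv> mono_span n (\<lambda>a. \<not> Poly_Mapping.keys a \<subseteq> V)"

lemma up_closed_coord: "up_closed (\<lambda>a :: nat \<Rightarrow>\<^sub>0 nat. \<not> Poly_Mapping.keys a \<subseteq> V)"
  by (auto simp: up_closed_def keys_plus_nat)

lemma adjoin_coord_ideal:
  assumes "i \<in> {1..n}"
  shows "mpoly.adjoin n (coord_ideal n V) (var i) = coord_ideal n (V - {i})"
  unfolding adjoin_mono_span_var[OF up_closed_coord assms]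
  by (rule mono_span_cong) auto

lemma nzd_coord_ideal:
  assumes "i \<in> {1..n}" "i \<in> V"
  shows "mpoly.nzd_mod n (coord_ideal n V) (var i)"
  unfolding nzd_mod_iff_colon colon_mono_span_var[OF assms(1)]
  using assms(2) by (auto simp: mono_span_def keys_plus_nat)

section \<open>A graded Nakayama argument\<close>

definition tdeg :: "(nat \<Rightarrow>\<^sub>0 nat) \<Rightarrow> nat" where
  "tdeg a = sum (Poly_Mapping.lookup a) (Poly_Mapping.keys a)"

lemma tdeg_eq_sum: "finite A \<Longrightarrow> Poly_Mapping.keys a \<subseteq> A \<Longrightarrow> tdeg a = sum (Poly_Mapping.lookup a) A"
  unfolding tdeg_def by (intro sum.mono_neutral_left) (auto simp: in_keys_iff)

lemma tdeg_add: "tdeg (a + b) = tdeg a + tdeg b"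
  using tdeg_eq_sum[of "Poly_Mapping.keys a \<union> Poly_Mapping.keys b"]
  by (simp add: keys_plus_nat lookup_add sum.distrib)

definition homogeneous :: "nat \<Rightarrow> 'k::field mpoly \<Rightarrow> bool" where
  "homogeneous k p \<longleftrightarrow> (\<forall>a\<in>Poly_Mapping.keys p. tdeg a = k)"

text \<open>For an ideal this amounts to homogeneity: homogeneous components are differences of
  consecutive truncations.\<close>

definition trunc_closed :: "'k::field mpoly set \<Rightarrow> bool" where
  "trunc_closed J \<longleftrightarrow> (\<forall>p\<in>J. \<forall>D. restrict_terms (\<lambda>a. tdeg a \<le> D) p \<in> J)"

text \<open>A form of degree k shifts all degrees by k. The case distinction excludes the default
  value 0 of D - k for k > D.\<close>

lemma trunc_mult:
  assumes "homogeneous k f"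
  shows "restrict_terms (\<lambda>a. tdeg a \<le> D) (f * r)
    = (if k \<le> D then f * restrict_terms (\<lambda>a. tdeg a \<le> D - k) r else 0)"
proof -
  define Q where "Q = (\<lambda>a. k + tdeg a \<le> D)"
  have Q: "restrict_terms Q r = (if k \<le> D then restrict_terms (\<lambda>a. tdeg a \<le> D - k) r else 0)"
    by (auto simp: Q_def restrict_terms_zero le_diff_conv2 add.commute)
  have "restrict_terms (\<lambda>a. tdeg a \<le> D) (f * r)
      = restrict_terms (\<lambda>a. tdeg a \<le> D) (f * restrict_terms Q r)
      + restrict_terms (\<lambda>a. tdeg a \<le> D) (f * restrict_terms (\<lambda>a. \<not> Q a) r)"
    by (simp only: restrict_terms_add[symmetric] distrib_left[symmetric] restrict_terms_split)
  also have "restrict_terms (\<lambda>a. tdeg a \<le> D) (f * restrict_terms Q r) = f * restrict_terms Q r"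
    using assms by (intro restrict_terms_id)
      (auto elim!: keys_mult_mem simp: homogeneous_def tdeg_add keys_restrict_terms Q_def)
  also have "restrict_terms (\<lambda>a. tdeg a \<le> D) (f * restrict_terms (\<lambda>a. \<not> Q a) r) = 0"
    using assms by (intro restrict_terms_zero)
      (auto elim!: keys_mult_mem simp: homogeneous_def tdeg_add keys_restrict_terms Q_def)
  finally show ?thesis by (simp add: Q)
qed

lemma trunc_closed_adjoin:
  assumes "mpoly.ideal_in n J" "trunc_closed J" "homogeneous k f"
  shows "trunc_closed (mpoly.adjoin n J f)"
  unfolding trunc_closed_def
proof (intro ballI allI)
  fix p D assume "p \<in> mpoly.adjoin n J f"
  then obtain j r where p: "p = j + f * r" "j \<in> J" "r \<in> carrier (mpoly_ring n)"
    by (auto elim!: mpoly.adjoinE)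
  define s where "s = (if k \<le> D then restrict_terms (\<lambda>a. tdeg a \<le> D - k) r else 0)"
  have "restrict_terms (\<lambda>a. tdeg a \<le> D) p = restrict_terms (\<lambda>a. tdeg a \<le> D) j + f * s"
    using assms(3) by (simp add: p restrict_terms_add trunc_mult s_def)
  moreover have "restrict_terms (\<lambda>a. tdeg a \<le> D) j \<in> J"
    using assms(2) p by (auto simp: trunc_closed_def)
  moreover have "s \<in> carrier (mpoly_ring n)"
    using p by (simp add: s_def restrict_terms_mem)
  ultimately show "restrict_terms (\<lambda>a. tdeg a \<le> D) p \<in> mpoly.adjoin n J f"
    by (simp add: mpoly.adjoinI)
qed

lemma trunc_closed_mono_span: "trunc_closed (mono_span n Q)"
  by (auto simp: trunc_closed_def mono_span_def keys_restrict_terms restrict_terms_mem)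

text \<open>From f y \<in> J, cancelling f modulo J + xR gives y = x z modulo J, and cancelling x
  then gives f z \<in> J again. So y lies in J + x^N R for every N, and homogeneity of J forces y
  \<in> J.\<close>

lemma nzd_mod_nakayama:
  assumes J: "mpoly.ideal_in n J" "trunc_closed J"
    and x: "x \<in> carrier (mpoly_ring n)" "homogeneous 1 x" "mpoly.nzd_mod n J x"
    and f: "f \<in> carrier (mpoly_ring n)" "mpoly.nzd_mod n (mpoly.adjoin n J x) f"
  shows "mpoly.nzd_mod n J f"
  unfolding mpoly.nzd_mod_def
proof safe
  note J' = mpoly.ideal_inD[OF J(1)]
  fix y assume y: "y \<in> carrier (mpoly_ring n)" "f * y \<in> J"
  have "\<exists>z\<in>carrier (mpoly_ring n). f * z \<in> J \<and> y - x ^ N * z \<in> J" for N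
  proof (induction N)
    case 0
    show ?case using y J' by auto
  next
    case (Suc N)
    then obtain z where z: "z \<in> carrier (mpoly_ring n)" "f * z \<in> J" "y - x ^ N * z \<in> J" by blast
    from z(2) mpoly.subset_adjoin[of J n x] have "f * z \<in> mpoly.adjoin n J x" by blast
    from mpoly.nzd_modD[OF f(2) this z(1)] obtain j z'
      where z': "z = j + x * z'" "j \<in> J" "z' \<in> carrier (mpoly_ring n)" by (auto elim!: mpoly.adjoinE)
    have "x * (f * z') = f * z - f * j" by (simp add: z' algebra_simps)
    also have "\<dots> \<in> J" by (rule J'(6)[OF z(2) J'(4)[OF f(1) z'(2)]])
    finally have fz': "f * z' \<in> J" using z' f by (rule_tac mpoly.nzd_modD[OF x(3)]) auto
    have "y - x ^ Suc N * z' = (y - x ^ N * z) + x ^ N * j"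
      by (simp add: z' algebra_simps)
    also have "\<dots> \<in> J" using z z' x by (intro J'(3,4)) simp_all
    finally show ?case using fz' z'(3) by blast
  qed
  \<comment> \<open>This bounds the degrees in y, so truncation at D fixes y, kills all multiples of
    x^(D+1) and maps J into itself.\<close>
  moreover define D where "D = Max (insert 0 (tdeg ` Poly_Mapping.keys y))"
  ultimately obtain z where z: "y - x ^ Suc D * z \<in> J" by blast
  have hom: "homogeneous k (x ^ k)" for k
  proof (induction k)
    case (Suc k)
    with x(2) show ?case
      by (auto simp: homogeneous_def tdeg_add elim!: keys_mult_mem)
  qed (simp add: homogeneous_def tdeg_def)
  have "restrict_terms (\<lambda>a. tdeg a \<le> D) ((y - x ^ Suc D * z) + x ^ Suc D * z)
      = restrict_terms (\<lambda>a. tdeg a \<le> D) (y - x ^ Suc D * z)"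
    unfolding restrict_terms_add trunc_mult[OF hom] by simp
  also have "\<dots> \<in> J" using J(2) z by (auto simp: trunc_closed_def)
  also have "restrict_terms (\<lambda>a. tdeg a \<le> D) ((y - x ^ Suc D * z) + x ^ Suc D * z) = y"
    by (simp, rule restrict_terms_id) (auto simp: D_def)
  finally show "y \<in> J" .
qed

text \<open>The exchange lemma keeps x a nonzerodivisor after each f is adjoined, and J + fR stays
  homogeneous because f is; so the Nakayama argument applies to each element in turn.\<close>

lemma wreg_nakayama:
  assumes "mpoly.ideal_in n J" "trunc_closed J"
    and x: "x \<in> carrier (mpoly_ring n)" "homogeneous 1 x" "mpoly.nzd_mod n J x"
    and "set fs \<subseteq> carrier (mpoly_ring n)" "\<And>f. f \<in> set fs \<Longrightarrow> \<exists>k. homogeneous k f"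
    and "mpoly.wreg n (mpoly.adjoin n J x) fs"
  shows "mpoly.wreg n J fs"
  using assms(1,2,5-)
proof (induction fs arbitrary: J)
  case (Cons f fs)
  have f: "f \<in> carrier (mpoly_ring n)" "mpoly.nzd_mod n (mpoly.adjoin n J x) f"
    using Cons.prems by auto
  obtain k where k: "homogeneous k f" using Cons.prems by auto
  have "mpoly.nzd_mod n (mpoly.adjoin n J f) x"
    using Cons.prems(1,3) x f by (rule_tac mpoly.nzd_mod_swap[of n J x f])
  then have "mpoly.wreg n (mpoly.adjoin n J f) fs"
    using Cons.prems f k trunc_closed_adjoin[of n J k f]
    by (rule_tac Cons.IH) (simp_all add: mpoly.ideal_in_adjoin mpoly.adjoin_commute[of n J f x])
  moreover have "mpoly.nzd_mod n J f"
    using Cons.prems(1-3) x f by (rule_tac nzd_mod_nakayama[of n J x f])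
  ultimately show ?case by simp
qed simp

section \<open>Elementary symmetric polynomials\<close>

definition expo :: "nat set \<Rightarrow> (nat \<Rightarrow> nat) \<Rightarrow> nat \<Rightarrow>\<^sub>0 nat" where
  "expo A h = Abs_poly_mapping (\<lambda>i. if i \<in> A then h i else 0)"

lemma lookup_expo: "finite A \<Longrightarrow> Poly_Mapping.lookup (expo A h) i = (if i \<in> A then h i else 0)"
  unfolding expo_def by (subst Abs_poly_mapping_inverse) (auto elim: finite_subset[rotated])

lemma keys_expo: "finite A \<Longrightarrow> Poly_Mapping.keys (expo A h) = {i \<in> A. h i \<noteq> 0}"
  by (auto simp: in_keys_iff lookup_expo split: if_splits)

definition elem_sym :: "nat \<Rightarrow> nat \<Rightarrow> 'k::field mpoly" where
  "elem_sym n k = (\<Sum>T | T \<subseteq> {1..n} \<and> card T = k. mon (expo T (\<lambda>_. 1)))"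

text \<open>The top degree comes first: once only k variables are left, E_k becomes their product,
  and after killing one of them E_(k-1), ..., E_1 match the k - 1 variables left.\<close>

fun elem_syms :: "nat \<Rightarrow> nat \<Rightarrow> 'k::field mpoly list" where
  "elem_syms n 0 = []"
| "elem_syms n (Suc k) = elem_sym n (Suc k) # elem_syms n k"

lemma length_elem_syms [simp]: "length (elem_syms n k) = k"
  by (induction k) auto

lemma keys_elem_sym:
  assumes "a \<in> Poly_Mapping.keys (elem_sym n k)"
  shows "Poly_Mapping.keys a \<subseteq> {1..n}" "tdeg a = k"
proof -
  have "a \<in> (\<Union>T\<in>{T. T \<subseteq> {1..n} \<and> card T = k}. Poly_Mapping.keys (mon (expo T (\<lambda>_. 1)) :: 'a mpoly))"
    using assms keys_sum unfolding elem_sym_def by (rule subsetD[rotated])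
  then obtain T where T: "T \<subseteq> {1..n}" "card T = k" "a = expo T (\<lambda>_. 1)" by (auto simp: mon_def)
  then have "finite T" by (auto intro: finite_subset)
  with T show "Poly_Mapping.keys a \<subseteq> {1..n}" "tdeg a = k"
    by (auto simp: keys_expo tdeg_def lookup_expo)
qed

lemma elem_syms_props:
  assumes "f \<in> set (elem_syms n k)"
  shows "f \<in> carrier (mpoly_ring n)" "\<exists>k. homogeneous k f" "\<And>a. a \<in> Poly_Mapping.keys f \<Longrightarrow> a \<noteq> 0"
proof -
  from assms obtain l where l: "f = elem_sym n (Suc l)" by (induction k) auto
  with keys_elem_sym[of _ n "Suc l", where 'a = 'a]
  show "f \<in> carrier (mpoly_ring n)" "\<exists>k. homogeneous k f"
    by (auto simp: mem_mpoly_ring_iff homogeneous_def)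
  have "tdeg 0 = 0" by (simp add: tdeg_def)
  with l keys_elem_sym(2)[of _ n "Suc l", where 'a = 'a]
  show "\<And>a. a \<in> Poly_Mapping.keys f \<Longrightarrow> a \<noteq> 0" by fastforce
qed

lemma mon_add: "mon (a + b) = mon a * mon b"
  by (simp add: mon_def mult_single)

lemma prod_var: "finite V \<Longrightarrow> prod var V = mon (expo V (\<lambda>_. 1))"
proof (induction V rule: finite_induct)
  case empty
  have "expo {} (\<lambda>_. 1) = 0" by (rule poly_mapping_eqI) (simp add: lookup_expo)
  then show ?case by (simp add: mon_def)
next
  case (insert i V)
  then have "expo (insert i V) (\<lambda>_. 1) = Poly_Mapping.single i 1 + expo V (\<lambda>_. 1)"
    by (intro poly_mapping_eqI) (auto simp: lookup_expo lookup_add lookup_single when_def)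
  with insert show ?case by (simp add: mon_add var_def)
qed

text \<open>Modulo the variables outside \<open>V\<close>, only the summand for \<open>T = V\<close> survives.\<close>

lemma elem_sym_coord_ideal:
  assumes "V \<subseteq> {1..n}"
  shows "prod var V - elem_sym n (card V) \<in> (coord_ideal n V :: 'k::field mpoly set)"
proof -
  have fin: "finite V" using assms by (auto intro: finite_subset)
  let ?X = "{T. T \<subseteq> {1..n} \<and> card T = card V}"
  have X: "finite ?X" "V \<in> ?X" using assms by (auto intro: finite_subset[of _ "Pow {1..n}"])
  note J = mpoly.ideal_inD[OF ideal_mono_span[OF up_closed_coord[of V], of n, where 'k = 'k]]
  have "mon (expo T (\<lambda>_. 1)) \<in> coord_ideal n V" if "T \<in> ?X - {V}" for T
  proof -
    have "finite T" using that by (auto intro: finite_subset)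
    moreover have "\<not> T \<subseteq> V" using that card_subset_eq[OF fin] by auto
    ultimately show ?thesis
      using that by (auto simp: mono_span_def mem_mpoly_ring_iff mon_def keys_expo)
  qed
  then have "(\<Sum>T\<in>?X - {V}. mon (expo T (\<lambda>_. 1)) :: 'k mpoly) \<in> coord_ideal n V"
    by (rule mpoly.ideal_in_sum[OF ideal_mono_span[OF up_closed_coord]])
  then have "- (\<Sum>T\<in>?X - {V}. mon (expo T (\<lambda>_. 1)) :: 'k mpoly) \<in> coord_ideal n V"
    by (rule J)
  then show ?thesis
    unfolding elem_sym_def sum.remove[OF X] prod_var[OF fin] by simp
qed

text \<open>While 0 < k < |V|, a variable of V can be killed by the graded Nakayama argument. When k
  = |V|, the first element is the product of the variables in V modulo
  \<open>coord_ideal n V\<close>, and each factor leads to one variable and one polynomial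
  less.\<close>

lemma wreg_elem_syms:
  assumes "V \<subseteq> {1..n}" "k \<le> card V"
  shows "mpoly.wreg n (coord_ideal n V :: 'k::field mpoly set) (elem_syms n k)"
  using assms
proof (induction "card V" arbitrary: V k rule: less_induct)
  case less
  have fin: "finite V" using less.prems by (auto intro: finite_subset)
  note J = ideal_mono_span[OF up_closed_coord[of V], of n, where 'k = 'k]
  have mem: "set (elem_syms n k) \<subseteq> carrier (mpoly_ring n :: 'k mpoly ring)" for k
    using elem_syms_props by blast
  have IH: "mpoly.wreg n (mpoly.adjoin n (coord_ideal n V :: 'k mpoly set) (var i)) (elem_syms n k')"
    and i: "i \<in> {1..n}"
    if "i \<in> V" "k' < card V" for i k'
  proof -
    show "i \<in> {1..n}" using that less.prems by auto
    moreover have "card (V - {i}) < card V" "k' \<le> card (V - {i})" "V - {i} \<subseteq> {1..n}"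
      using that fin less.prems by auto
    ultimately show "mpoly.wreg n (mpoly.adjoin n (coord_ideal n V :: 'k mpoly set) (var i)) (elem_syms n k')"
      using less.hyps by (simp add: adjoin_coord_ideal)
  qed
  consider "k = 0" | "0 < k" "k < card V" | k' where "k = Suc k'" "k = card V"
    using less.prems(2) by (cases k) force+
  then show ?case
  proof cases
    case 2
    then obtain i where "i \<in> V" by fastforce
    moreover have "homogeneous 1 (var i :: 'k mpoly)"
      by (simp add: homogeneous_def var_def mon_def tdeg_def)
    ultimately show ?thesis
      using 2 IH[of i k] i[of i k] mem[of k] elem_syms_props(2)
      by (intro wreg_nakayama[OF J trunc_closed_mono_span, where x = "var i"])
         (simp_all add: var_mem nzd_coord_ideal)
  next
    case 3
    have "mpoly.wreg n (coord_ideal n V) (prod var V # elem_syms n k' :: 'k mpoly list)"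
      using 3 IH[of _ k'] i[of _ k'] mem[of k'] fin
      by (intro mpoly.wreg_prod J) (auto intro: nzd_coord_ideal var_mem)
    moreover have "prod var V - elem_sym n k \<in> (coord_ideal n V :: 'k mpoly set)"
      using elem_sym_coord_ideal[OF less.prems(1)] 3 by simp
    ultimately show ?thesis
      using 3 mpoly.nzd_mod_cong[OF J] mpoly.adjoin_cong[OF J] by simp
  qed simp
qed

section \<open>Ideals of Veronese type\<close>

text \<open>This describes the ideal of Veronese type in the variables of V, enlarged by all
  variables outside V. Divisibility by a generator has become an inequality, and zero bounds and D =
  0 are allowed, so that the class is stable under the colons and sums used below.\<close>

definition trunc_ge :: "nat set \<Rightarrow> nat \<Rightarrow> (nat \<Rightarrow> nat) \<Rightarrow> (nat \<Rightarrow>\<^sub>0 nat) \<Rightarrow> bool" where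
  "trunc_ge V D e a \<longleftrightarrow> \<not> Poly_Mapping.keys a \<subseteq> V \<or> D \<le> (\<Sum>i\<in>V. min (Poly_Mapping.lookup a i) (e i))"

lemma up_closed_trunc_ge: "up_closed (trunc_ge V D e)"
  unfolding up_closed_def
proof (intro allI impI)
  fix a b assume "trunc_ge V D e a"
  moreover have "(\<Sum>i\<in>V. min (Poly_Mapping.lookup a i) (e i)) \<le> (\<Sum>i\<in>V. min (Poly_Mapping.lookup (a + b) i) (e i))"
    by (intro sum_mono) (auto simp: lookup_add)
  ultimately show "trunc_ge V D e (a + b)" by (auto simp: trunc_ge_def keys_plus_nat)
qed

text \<open>The colon by x_i lowers D and e_i by one, since min(a_i + 1, e_i) = 1 + min(a_i, e_i -
  1) when e_i is positive.\<close>

lemma trunc_ge_single: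
  assumes "finite V" "i \<in> V" "1 \<le> e i" "1 \<le> D"
  shows "trunc_ge V D e (a + Poly_Mapping.single i 1) \<longleftrightarrow> trunc_ge V (D - 1) (e(i := e i - 1)) a"
proof -
  have "(\<Sum>j\<in>V. min (Poly_Mapping.lookup (a + Poly_Mapping.single i 1) j) (e j))
      = min (Poly_Mapping.lookup a i + 1) (e i) + (\<Sum>j\<in>V - {i}. min (Poly_Mapping.lookup a j) (e j))"
    by (subst sum.remove[OF assms(1,2)])
       (auto simp: lookup_add lookup_single when_def intro!: sum.cong)
  also have "(\<Sum>j\<in>V - {i}. min (Poly_Mapping.lookup a j) (e j)) = (\<Sum>j\<in>V - {i}. min (Poly_Mapping.lookup a j) ((e(i := e i - 1)) j))"
    by (intro sum.cong) auto
  also have "min (Poly_Mapping.lookup a i + 1) (e i) = 1 + min (Poly_Mapping.lookup a i) ((e(i := e i - 1)) i)"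
    using assms by auto
  finally have "(\<Sum>j\<in>V. min (Poly_Mapping.lookup (a + Poly_Mapping.single i 1) j) (e j))
      = 1 + (\<Sum>j\<in>V. min (Poly_Mapping.lookup a j) ((e(i := e i - 1)) j))"
    by (simp only: sum.remove[OF assms(1,2)] add.assoc)
  then show ?thesis using assms by (auto simp: trunc_ge_def keys_plus_nat)
qed

lemma trunc_ge_remove:
  assumes "finite V" "i \<in> V"
  shows "trunc_ge V D e a \<or> i \<in> Poly_Mapping.keys a \<longleftrightarrow> trunc_ge (V - {i}) D e a"
proof (cases "i \<in> Poly_Mapping.keys a")
  case False
  then show ?thesis by (auto simp: trunc_ge_def sum.remove[OF assms] in_keys_iff)
qed (auto simp: trunc_ge_def)

text \<open>
  Iterating colons and sums with variables filters the quotient by copies of polynomial rings in at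
  least \<open>k\<close> variables, and on each of these the sequence is regular.
\<close>

lemma wreg_trunc_ge:
  assumes "V \<subseteq> {1..n}" "k \<le> card V" "k + sum e V + 1 \<le> D + card V"
  shows "mpoly.wreg n (mono_span n (trunc_ge V D e) :: 'k::field mpoly set) (elem_syms n k)"
  using assms
proof (induction "sum e V" arbitrary: V D e rule: less_induct)
  case less
  have fin: "finite V" using less.prems by (auto intro: finite_subset)
  have mem: "set (elem_syms n k) \<subseteq> carrier (mpoly_ring n :: 'k mpoly ring)"
    using elem_syms_props by blast
  \<comment> \<open>The cases are the unit ideal, the zero ideal of the polynomial ring in V, and
    the remaining one, where some e_i is positive and the exact sequence for x_i applies.\<close>
  consider "D = 0" | "sum e V < D" | "1 \<le> D" "D \<le> sum e V" by linarith
  then show ?case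
  proof cases
    case 1
    then have "mono_span n (trunc_ge V D e) = carrier (mpoly_ring n :: 'k mpoly ring)"
      by (simp add: mono_span_def trunc_ge_def)
    then show ?thesis using mem by (simp add: mpoly.wreg_carrier)
  next
    case 2
    have "\<not> D \<le> (\<Sum>i\<in>V. min (Poly_Mapping.lookup a i) (e i))" for a
      using 2 sum_mono[of V "\<lambda>i. min (Poly_Mapping.lookup a i) (e i)" e] by simp
    then have "mono_span n (trunc_ge V D e) = (coord_ideal n V :: 'k mpoly set)"
      by (intro mono_span_cong) (simp add: trunc_ge_def)
    then show ?thesis using less.prems wreg_elem_syms by simp
  next
    case 3
    then have "sum e V \<noteq> 0" by simp
    then obtain i where i: "i \<in> V" "1 \<le> e i"
      by (metis One_nat_def Suc_leI neq0_conv sum.neutral)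
    have i': "i \<in> {1..n}" using i less.prems by auto
    have se: "sum e V = e i + sum e (V - {i})" by (rule sum.remove[OF fin i(1)])
    have se': "sum (e(i := e i - 1)) V = e i - 1 + sum e (V - {i})"
      by (subst sum.remove[OF fin i(1)]) (auto intro!: sum.cong)
    have cV: "card V = Suc (card (V - {i}))" using card.remove[OF fin i(1)] .
    \<comment> \<open>D and the sum of the bounds both drop by one, so the numerical hypothesis is
      preserved.\<close>
    have "mpoly.wreg n (mono_span n (trunc_ge V (D - 1) (e(i := e i - 1))) :: 'k mpoly set) (elem_syms n k)"
      using less.prems i 3 se se' by (intro less.hyps) simp_all
    then have "mpoly.wreg n (mpoly.colon n (mono_span n (trunc_ge V D e) :: 'k mpoly set) (var i)) (elem_syms n k)"
      by (simp only: colon_mono_span_var[OF i'] trunc_ge_single[where e = e, OF fin i 3(1)])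
    moreover have "mpoly.wreg n (mono_span n (trunc_ge (V - {i}) D e) :: 'k mpoly set) (elem_syms n k)"
    proof (rule less.hyps)
      show "sum e (V - {i}) < sum e V" using se i(2) by linarith
      show "V - {i} \<subseteq> {1..n}" using less.prems(1) by blast
      \<comment> \<open>With D \<le> sum e V the numerical hypothesis yields k < |V|, so i can be
        spared; the second inequality survives because e_i \<ge> 1.\<close>
      show "k \<le> card (V - {i})" "k + sum e (V - {i}) + 1 \<le> D + card (V - {i})"
        using less.prems(3) se i(2) 3 cV by linarith+
    qed
    then have "mpoly.wreg n (mpoly.adjoin n (mono_span n (trunc_ge V D e) :: 'k mpoly set) (var i)) (elem_syms n k)"
      using i by (simp add: adjoin_mono_span_var[OF up_closed_trunc_ge i'] trunc_ge_remove[OF fin])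
    ultimately show ?thesis
      using mem by (intro mpoly.wreg_exact[OF ideal_mono_span[OF up_closed_trunc_ge] var_mem[OF i']])
  qed
qed

section \<open>Generated ideals as spans of monomials\<close>

lemma ideal_iff_ideal_in: "ideal I (mpoly_ring n) \<longleftrightarrow> mpoly.ideal_in n (I :: 'k::field mpoly set)"
proof
  assume "ideal I (mpoly_ring n)"
  then interpret ideal I "mpoly_ring n" .
  show "mpoly.ideal_in n I"
    unfolding mpoly.ideal_in_def
    using a_subset additive_subgroup.zero_closed[OF is_additive_subgroup]
      additive_subgroup.a_closed[OF is_additive_subgroup] I_l_closed
    by simp
next
  assume I: "mpoly.ideal_in n I"
  note I' = mpoly.ideal_inD[OF I]
  interpret cring "mpoly_ring n :: 'k mpoly ring" by (rule mpoly_ring_cring)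
  have inv: "\<ominus>\<^bsub>mpoly_ring n\<^esub> x = - x" if "x \<in> carrier (mpoly_ring n)" for x :: "'k mpoly"
    using minus_equality[of "- x" x] that by simp
  have "x * r \<in> I" if "x \<in> I" "r \<in> carrier (mpoly_ring n)" for x r
    using I'(4)[OF that(2,1)] by (simp add: mult.commute)
  then show "ideal I (mpoly_ring n)"
    by (intro idealI[OF ring_axioms] add.subgroupI) (use I' inv in auto)
qed

lemma genideal_mon:
  assumes "\<And>g. g \<in> G \<Longrightarrow> Poly_Mapping.keys g \<subseteq> {1..n}"
  shows "genideal (mpoly_ring n) (mon ` G) = (mono_span n (\<lambda>a. \<exists>g\<in>G. \<exists>b. a = g + b) :: 'k::field mpoly set)"
    (is "?L = ?R")
proof
  interpret cring "mpoly_ring n :: 'k mpoly ring" by (rule mpoly_ring_cring)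
  have sub: "mon ` G \<subseteq> carrier (mpoly_ring n :: 'k mpoly ring)" using assms by (intro image_subsetI mon_mem)
  have "up_closed (\<lambda>a. \<exists>g\<in>G. \<exists>b. a = g + b)"
    unfolding up_closed_def by (metis add.assoc)
  then have "ideal ?R (mpoly_ring n)" by (simp add: ideal_iff_ideal_in ideal_mono_span)
  moreover have "mon g \<in> ?R" if "g \<in> G" for g
  proof -
    have "g = g + 0" by simp
    with that have "\<exists>h\<in>G. \<exists>b. g = h + b" by blast
    with mon_mem[OF assms[OF that]] show ?thesis by (simp add: mono_span_def mon_def)
  qed
  ultimately show "?L \<subseteq> ?R" by (intro genideal_minimal) auto
  show "?R \<subseteq> ?L"
  proof
    fix p assume p: "p \<in> ?R"
    have L: "mpoly.ideal_in n ?L" using genideal_ideal[OF sub] by (simp add: ideal_iff_ideal_in)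
    have "(\<Sum>a\<in>Poly_Mapping.keys p. Poly_Mapping.single a (Poly_Mapping.lookup p a)) \<in> ?L"
    proof (rule mpoly.ideal_in_sum[OF L])
      fix a assume a: "a \<in> Poly_Mapping.keys p"
      with p obtain g b where g: "g \<in> G" "a = g + b" "Poly_Mapping.keys a \<subseteq> {1..n}"
        by (auto simp: mono_span_def mem_mpoly_ring_iff)
      have "Poly_Mapping.single a (Poly_Mapping.lookup p a) = Poly_Mapping.single b (Poly_Mapping.lookup p a) * mon g"
        by (simp add: mon_def mult_single g add.commute)
      also have "\<dots> \<in> ?L"
      proof (rule mpoly.ideal_inD(4)[OF L])
        show "mon g \<in> ?L" using genideal_self[OF sub] g by auto
        show "Poly_Mapping.single b (Poly_Mapping.lookup p a) \<in> carrier (mpoly_ring n)"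
          using g by (auto simp: mem_mpoly_ring_iff keys_plus_nat split: if_splits)
      qed
      finally show "Poly_Mapping.single a (Poly_Mapping.lookup p a) \<in> ?L" .
    qed
    then show "p \<in> ?L" by (simp only: sum_single_eq)
  qed
qed

lemma max_ideal_eq: "max_ideal n = mono_span n (\<lambda>a. a \<noteq> 0)"
proof -
  have "var ` {1..n} = mon ` ((\<lambda>i. Poly_Mapping.single i 1) ` {1..n})"
    by (auto simp: var_def)
  then have "max_ideal n = mono_span n (\<lambda>a. \<exists>g\<in>(\<lambda>i. Poly_Mapping.single i 1) ` {1..n}. \<exists>b. a = g + b)"
    unfolding max_ideal_def by (rule ssubst) (rule genideal_mon, auto split: if_splits)
  also have "\<dots> = mono_span n (\<lambda>a. a \<noteq> 0)"
  proof (rule mono_span_cong)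
    fix a :: "nat \<Rightarrow>\<^sub>0 nat" assume a: "Poly_Mapping.keys a \<subseteq> {1..n}"
    show "(\<exists>g\<in>(\<lambda>i. Poly_Mapping.single i 1) ` {1..n}. \<exists>b. a = g + b) \<longleftrightarrow> a \<noteq> 0"
    proof
      assume "\<exists>g\<in>(\<lambda>i. Poly_Mapping.single i 1) ` {1..n}. \<exists>b. a = g + b"
      then obtain i b where "a = Poly_Mapping.single i 1 + b" by blast
      then have "i \<in> Poly_Mapping.keys a" by (simp add: keys_plus_nat)
      then show "a \<noteq> 0" by auto
    next
      assume "a \<noteq> 0"
      then obtain i where "i \<in> Poly_Mapping.keys a" using keys_eq_empty by blast
      with a keys_eq_single_plus[of i a]
      show "\<exists>g\<in>(\<lambda>i. Poly_Mapping.single i 1) ` {1..n}. \<exists>b. a = g + b" by blast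
    qed
  qed
  finally show ?thesis .
qed

text \<open>Greedy choice: x takes as much of d as \<open>h x\<close> permits, and the rest goes to
  the other indices. It supplies the generator dividing a given monomial.\<close>

lemma sum_intermediate:
  fixes h :: "'x \<Rightarrow> nat"
  assumes "finite A" "d \<le> sum h A"
  shows "\<exists>g. (\<forall>i\<in>A. g i \<le> h i) \<and> sum g A = d"
  using assms
proof (induction A arbitrary: d rule: finite_induct)
  case (insert x A)
  have "d - min d (h x) \<le> sum h A" using insert.prems insert.hyps by simp
  from insert.IH[OF this] obtain g
    where g: "\<forall>i\<in>A. g i \<le> h i" "sum g A = d - min d (h x)" by blast
  have "sum (g(x := min d (h x))) A = sum g A" using insert.hyps by (intro sum.cong) auto
  with g insert.hyps show ?case by (intro exI[of _ "g(x := min d (h x))"]) auto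
qed simp

text \<open>The exponents of a generator dividing x^a are bounded by the minima of a_i and e_i, and
  a choice of total degree d exists iff these minima add up to at least d.\<close>

lemma veronese_ideal_eq: "veronese_ideal n d e = mono_span n (trunc_ge {1..n} d e)"
proof -
  let ?G = "{a. Poly_Mapping.keys a \<subseteq> {1..n} \<and> (\<Sum>i = 1..n. Poly_Mapping.lookup a i) = d
    \<and> (\<forall>i \<in> {1..n}. Poly_Mapping.lookup a i \<le> e i)}"
  have "veronese_ideal n d e = genideal (mpoly_ring n) (mon ` ?G)"
    unfolding veronese_ideal_def by (rule arg_cong[where f = "genideal _"]) blast
  also have "\<dots> = mono_span n (\<lambda>a. \<exists>g\<in>?G. \<exists>b. a = g + b)"
    by (rule genideal_mon) blast
  also have "\<dots> = mono_span n (trunc_ge {1..n} d e)"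
  proof (rule mono_span_cong)
    fix a :: "nat \<Rightarrow>\<^sub>0 nat" assume a: "Poly_Mapping.keys a \<subseteq> {1..n}"
    show "(\<exists>g\<in>?G. \<exists>b. a = g + b) \<longleftrightarrow> trunc_ge {1..n} d e a"
    proof
      assume "\<exists>g\<in>?G. \<exists>b. a = g + b"
      then obtain g b where g: "g \<in> ?G" "a = g + b" by blast
      then have "d = (\<Sum>i = 1..n. min (Poly_Mapping.lookup g i) (e i))"
        by (auto intro!: sum.cong simp: min_def)
      then have "trunc_ge {1..n} d e g" by (simp add: trunc_ge_def)
      then show "trunc_ge {1..n} d e a"
        using up_closed_trunc_ge g unfolding up_closed_def by blast
    next
      assume "trunc_ge {1..n} d e a"
      with a have "d \<le> (\<Sum>i = 1..n. min (Poly_Mapping.lookup a i) (e i))" by (auto simp: trunc_ge_def)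
      then obtain g where g: "\<And>i. i \<in> {1..n} \<Longrightarrow> g i \<le> min (Poly_Mapping.lookup a i) (e i)" "sum g {1..n} = d"
        using sum_intermediate[of "{1..n}" d] by blast
      define b where "b = expo {1..n} g"
      have lb: "Poly_Mapping.lookup b i = (if i \<in> {1..n} then g i else 0)" for i
        by (simp add: b_def lookup_expo)
      have "b \<in> ?G" using g by (auto simp: lb in_keys_iff split: if_splits)
      moreover have "a = b + (a - b)"
        using g by (intro poly_mapping_eqI) (auto simp: lookup_add lookup_minus lb)
      ultimately show "\<exists>g\<in>?G. \<exists>b. a = g + b" by blast
    qed
  qed
  finally show ?thesis .
qed

section \<open>Regular sequences on the quotient module\<close>

lemma list_smult_quotient_module:
  fixes I :: "'k::field mpoly set"
  assumes "ideal I (mpoly_ring n)" "set as \<subseteq> carrier (mpoly_ring n)"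
  shows "list_smult (quotient_module (mpoly_ring n) I) as
    = (\<lambda>x. I +>\<^bsub>mpoly_ring n\<^esub> x) ` mpoly.adjoin_list n I as"
  using assms(2)
proof (induction as)
  interpret I: ideal I "mpoly_ring n" by (rule assms(1))
  case Nil
  have "I +>\<^bsub>mpoly_ring n\<^esub> x = I" if "x \<in> I" for x
    using that by (rule I.a_rcos_const)
  moreover have "0 \<in> I" using additive_subgroup.zero_closed[OF I.is_additive_subgroup] by simp
  ultimately show ?case by (auto simp: FactRing_def image_iff)
next
  interpret I: ideal I "mpoly_ring n" by (rule assms(1))
  case (Cons a as)
  have I': "mpoly.ideal_in n I" using assms(1) by (simp add: ideal_iff_ideal_in)
  have J: "mpoly.ideal_in n (mpoly.adjoin_list n I as)"
    using I' Cons.prems by (intro mpoly.ideal_in_adjoin_list) auto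
  have eq: "((I +>\<^bsub>mpoly_ring n\<^esub> a) \<otimes>\<^bsub>mpoly_ring n Quot I\<^esub> (I +>\<^bsub>mpoly_ring n\<^esub> x))
      \<oplus>\<^bsub>mpoly_ring n Quot I\<^esub> (I +>\<^bsub>mpoly_ring n\<^esub> y) = I +>\<^bsub>mpoly_ring n\<^esub> (y + a * x)"
    if "x \<in> carrier (mpoly_ring n)" "y \<in> mpoly.adjoin_list n I as" for x y
    using that Cons.prems mpoly.ideal_inD(1)[OF J]
    by (simp add: FactRing_def I.rcoset_mult_add I.a_rcos_sum add.commute)
  have car: "carrier (mpoly_ring n Quot I) = (\<lambda>x. I +>\<^bsub>mpoly_ring n\<^esub> x) ` carrier (mpoly_ring n)"
    by (auto simp: FactRing_def A_RCOSETS_def' )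
  show ?case (is "?L = ?R")
  proof
    show "?L \<subseteq> ?R"
      using Cons.IH Cons.prems
      by (auto simp: car eq mpoly.adjoin_list_adjoin intro!: imageI mpoly.adjoinI)
    show "?R \<subseteq> ?L"
    proof
      fix X assume "X \<in> ?R"
      then obtain y x where X: "X = I +>\<^bsub>mpoly_ring n\<^esub> (y + a * x)"
        "y \<in> mpoly.adjoin_list n I as" "x \<in> carrier (mpoly_ring n)"
        by (auto simp: mpoly.adjoin_list_adjoin elim!: mpoly.adjoinE)
      then show "X \<in> ?L"
        using Cons.IH Cons.prems eq[of x y, symmetric] by (auto simp: car)
    qed
  qed
qed

text \<open>J is a union of cosets of I, so membership can be tested on cosets. This pulls
  conditions on the quotient module back to the polynomial ring.\<close>

lemma coset_mem_image_iff:
  fixes I :: "'k::field mpoly set"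
  assumes "ideal I (mpoly_ring n)" "mpoly.ideal_in n J" "I \<subseteq> J" "x \<in> carrier (mpoly_ring n)"
  shows "I +>\<^bsub>mpoly_ring n\<^esub> x \<in> (\<lambda>x. I +>\<^bsub>mpoly_ring n\<^esub> x) ` J \<longleftrightarrow> x \<in> J"
proof
  interpret I: ideal I "mpoly_ring n" by (rule assms(1))
  assume "I +>\<^bsub>mpoly_ring n\<^esub> x \<in> (\<lambda>x. I +>\<^bsub>mpoly_ring n\<^esub> x) ` J"
  then obtain y where y: "I +>\<^bsub>mpoly_ring n\<^esub> x = I +>\<^bsub>mpoly_ring n\<^esub> y" "y \<in> J" by auto
  then have "x \<in> I +>\<^bsub>mpoly_ring n\<^esub> y" using I.a_rcos_self[OF assms(4)] by simp
  then obtain h where "h \<in> I" "x = h + y" by (auto simp: a_r_coset_def')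
  with y assms(3) show "x \<in> J" using mpoly.ideal_inD(3)[OF assms(2)] by auto
qed auto

lemma regular_sequence_quotient_iff:
  fixes I :: "'k::field mpoly set"
  assumes "mpoly.ideal_in n I"
  shows "regular_sequence (mpoly_ring n) (quotient_module (mpoly_ring n) I) as \<longleftrightarrow>
    set as \<subseteq> carrier (mpoly_ring n) \<and> mpoly.wreg n I as \<and> mpoly.adjoin_list n I as \<noteq> carrier (mpoly_ring n)"
proof (cases "set as \<subseteq> carrier (mpoly_ring n)")
  case True
  have I: "ideal I (mpoly_ring n)" using assms by (simp add: ideal_iff_ideal_in)
  interpret I: ideal I "mpoly_ring n" by (rule I)
  have car: "carrier (mpoly_ring n Quot I) = (\<lambda>x. I +>\<^bsub>mpoly_ring n\<^esub> x) ` carrier (mpoly_ring n)"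
    by (auto simp: FactRing_def A_RCOSETS_def')
  have sub: "set (take i as) \<subseteq> carrier (mpoly_ring n)" for i
    using True set_take_subset[of i as] by blast
  have J: "mpoly.ideal_in n (mpoly.adjoin_list n I bs)" if "set bs \<subseteq> carrier (mpoly_ring n)" for bs
    using assms that by (rule mpoly.ideal_in_adjoin_list)
  have IJ: "I \<subseteq> mpoly.adjoin_list n I bs" for bs
  proof (induction bs)
    case (Cons b bs)
    then show ?case using mpoly.subset_adjoin by (simp add: mpoly.adjoin_list_adjoin) (rule subset_trans)
  qed simp
  note mem = coset_mem_image_iff[OF I J IJ]
  have "((\<forall>X\<in>carrier (mpoly_ring n Quot I).
      (I +>\<^bsub>mpoly_ring n\<^esub> as ! i) \<otimes>\<^bsub>mpoly_ring n Quot I\<^esub> X \<in> list_smult (quotient_module (mpoly_ring n) I) (take i as)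
        \<longrightarrow> X \<in> list_smult (quotient_module (mpoly_ring n) I) (take i as))
      \<longleftrightarrow> mpoly.nzd_mod n (mpoly.adjoin_list n I (take i as)) (as ! i))"
    if "i < length as" for i
  proof -
    have ai: "as ! i \<in> carrier (mpoly_ring n)" using that True by auto
    have "(I +>\<^bsub>mpoly_ring n\<^esub> as ! i) \<otimes>\<^bsub>mpoly_ring n Quot I\<^esub> (I +>\<^bsub>mpoly_ring n\<^esub> x)
        = I +>\<^bsub>mpoly_ring n\<^esub> (as ! i * x)" if "x \<in> carrier (mpoly_ring n)" for x
      using that ai by (simp add: FactRing_def I.rcoset_mult_add)
    then show ?thesis
      using ai sub by (simp add: car list_smult_quotient_module[OF I sub] mem mpoly.nzd_mod_def)
  qed
  moreover have "list_smult (quotient_module (mpoly_ring n) I) as = carrier (mpoly_ring n Quot I)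
      \<longleftrightarrow> mpoly.adjoin_list n I as = carrier (mpoly_ring n)"
  proof
    assume eq: "list_smult (quotient_module (mpoly_ring n) I) as = carrier (mpoly_ring n Quot I)"
    have "x \<in> mpoly.adjoin_list n I as" if x: "x \<in> carrier (mpoly_ring n)" for x
      using eq mem[OF True x] x by (auto simp: car list_smult_quotient_module[OF I True])
    with mpoly.ideal_inD(1)[OF J[OF True]] show "mpoly.adjoin_list n I as = carrier (mpoly_ring n)" by blast
  qed (simp add: list_smult_quotient_module[OF I True] car)
  ultimately show ?thesis
    using True by (simp add: regular_sequence_def mpoly.wreg_iff)
qed (simp add: regular_sequence_def)

section \<open>Algebraic dependence and the upper bound\<close>

lemma lookup_le_tdeg: "Poly_Mapping.lookup a i \<le> tdeg a"
  by (cases "i \<in> Poly_Mapping.keys a") (auto simp: tdeg_def in_keys_iff intro: member_le_sum)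

lemma tdeg_power_le:
  assumes "\<And>a. a \<in> Poly_Mapping.keys g \<Longrightarrow> tdeg a \<le> M" "a \<in> Poly_Mapping.keys (g ^ k)"
  shows "tdeg a \<le> M * k"
  using assms(2)
proof (induction k arbitrary: a)
  case (Suc k)
  then show ?case using assms(1) by (fastforce elim!: keys_mult_mem simp: tdeg_add intro: add_mono)
qed (simp add: tdeg_def)

lemma tdeg_power_ge:
  assumes "\<And>a. a \<in> Poly_Mapping.keys g \<Longrightarrow> m \<le> tdeg a" "a \<in> Poly_Mapping.keys (g ^ k)"
  shows "m * k \<le> tdeg a"
  using assms(2)
proof (induction k arbitrary: a)
  case (Suc k)
  then show ?case using assms(1) by (fastforce elim!: keys_mult_mem simp: tdeg_add intro: add_mono)
qed (simp add: tdeg_def)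

lemma tdeg_list_monom_le:
  assumes "\<And>g a. g \<in> set gs \<Longrightarrow> a \<in> Poly_Mapping.keys g \<Longrightarrow> tdeg a \<le> M"
    and "a \<in> Poly_Mapping.keys (list_monom gs \<alpha>)"
  shows "tdeg a \<le> M * sum_list \<alpha>"
  using assms
proof (induction gs \<alpha> arbitrary: a rule: list_monom.induct)
  case (1 g gs k ks)
  from "1.prems"(2) obtain b c where a: "a = b + c" "b \<in> Poly_Mapping.keys (g ^ k)"
    "c \<in> Poly_Mapping.keys (list_monom gs ks)" by (auto elim!: keys_mult_mem)
  have "tdeg b \<le> M * k" using "1.prems"(1) a(2) by (intro tdeg_power_le[of g]) auto
  moreover have "tdeg c \<le> M * sum_list ks" using "1.prems"(1) a(3) by (intro "1.IH") auto
  ultimately show ?case by (simp add: a tdeg_add distrib_left)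
qed (simp_all add: tdeg_def)

lemma sum_list_bounded: "set \<alpha> \<subseteq> {..<B} \<Longrightarrow> sum_list \<alpha> \<le> length \<alpha> * (B :: nat)"
  by (induction \<alpha>) auto

lemma lookup_scalar_mult:
  "Poly_Mapping.lookup (Poly_Mapping.single 0 c * p) b = c * Poly_Mapping.lookup (p :: 'k::field mpoly) b"
  by (simp add: map.rep_eq when_def flip: mult_map_scale_conv_mult)

text \<open>Counting: s elements have B^s monomials with exponents below B, while their terms in the
  variables of U have exponents at most L, leaving (L + 1)^|U| coefficients to annihilate, with L
  linear in B. As |U| < s, a large B gives more unknowns than equations.\<close>

lemma algebraic_dependence:
  fixes gs :: "'k::field mpoly list"
  assumes "finite U" "card U < length gs"
  obtains X c where "finite X" "X \<noteq> {}" "\<And>\<alpha>. \<alpha> \<in> X \<Longrightarrow> length \<alpha> = length gs \<and> c \<alpha> \<noteq> 0"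
    "\<And>b. Poly_Mapping.keys b \<subseteq> U \<Longrightarrow>
      Poly_Mapping.lookup (\<Sum>\<alpha>\<in>X. Poly_Mapping.single 0 (c \<alpha>) * list_monom gs \<alpha>) b = 0"
proof -
  define s where "s = length gs"
  define M where "M = Max (insert 0 (\<Union>g\<in>set gs. tdeg ` Poly_Mapping.keys g))"
  have M: "tdeg a \<le> M" if "g \<in> set gs" "a \<in> Poly_Mapping.keys g" for g a
    unfolding M_def using that by (intro Max_ge) auto
  \<comment> \<open>The choice gives L + 1 \<le> (Ms + 1) B and (Ms + 1)^|U| < B, hence (L + 1)^|U|
    < B^(|U| + 1) \<le> B^s.\<close>
  define B where "B = Suc ((M * s + 1) ^ card U)"
  have "1 \<le> B" by (simp add: B_def)
  define L where "L = M * (s * B)"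
  define X0 where "X0 = {\<alpha>. set \<alpha> \<subseteq> {..<B} \<and> length \<alpha> = s}"
  define Y where "Y = expo U ` (U \<rightarrow>\<^sub>E {..L})"
  have fin: "finite X0" "finite Y"
    using assms(1) by (auto simp: X0_def Y_def finite_lists_length_eq intro: finite_PiE)
  have "card Y \<le> card (U \<rightarrow>\<^sub>E {..L})"
    unfolding Y_def using assms(1) by (intro card_image_le finite_PiE) auto
  also have "\<dots> = Suc L ^ card U" using assms(1) by (simp add: card_PiE)
  also have "\<dots> \<le> ((M * s + 1) * B) ^ card U"
    using \<open>1 \<le> B\<close> by (intro power_mono) (simp_all add: L_def mult.assoc)
  also have "\<dots> = (M * s + 1) ^ card U * B ^ card U" by (rule power_mult_distrib)
  also have "\<dots> < B * B ^ card U"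
    by (intro mult_strict_right_mono) (simp_all add: B_def)
  also have "\<dots> = B ^ Suc (card U)" by simp
  also have "\<dots> \<le> B ^ s"
    using assms(2) by (intro power_increasing) (simp_all add: s_def B_def)
  also have "\<dots> = card X0" by (simp add: X0_def card_lists_length_eq)
  finally have "card Y < card X0" .
  from homogeneous_system[OF fin(2,1) this, of "\<lambda>\<alpha> y. Poly_Mapping.lookup (list_monom gs \<alpha>) y"]
  obtain c where c: "\<exists>\<alpha>\<in>X0. c \<alpha> \<noteq> 0"
    "\<And>y. y \<in> Y \<Longrightarrow> (\<Sum>\<alpha>\<in>X0. c \<alpha> * Poly_Mapping.lookup (list_monom gs \<alpha>) y) = 0" by blast
  \<comment> \<open>Dropping the zero coefficients leaves only units, as
    \<open>wreg_relation\<close> demands.\<close>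
  define X where "X = {\<alpha>\<in>X0. c \<alpha> \<noteq> 0}"
  show ?thesis
  proof
    show "finite X" "X \<noteq> {}" using fin c by (auto simp: X_def)
    show "length \<alpha> = length gs \<and> c \<alpha> \<noteq> 0" if "\<alpha> \<in> X" for \<alpha>
      using that by (simp add: X_def X0_def s_def)
    fix b :: "nat \<Rightarrow>\<^sub>0 nat" assume b: "Poly_Mapping.keys b \<subseteq> U"
    have "Poly_Mapping.lookup (\<Sum>\<alpha>\<in>X. Poly_Mapping.single 0 (c \<alpha>) * list_monom gs \<alpha>) b
        = (\<Sum>\<alpha>\<in>X. c \<alpha> * Poly_Mapping.lookup (list_monom gs \<alpha>) b)"
      by (simp add: lookup_sum lookup_scalar_mult)
    also have "\<dots> = (\<Sum>\<alpha>\<in>X0. c \<alpha> * Poly_Mapping.lookup (list_monom gs \<alpha>) b)"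
      using fin by (intro sum.mono_neutral_left) (auto simp: X_def)
    also have "\<dots> = 0"
    proof (cases "\<forall>i\<in>U. Poly_Mapping.lookup b i \<le> L")
      case True
      have "b = expo U (restrict (Poly_Mapping.lookup b) U)"
        using b assms(1) by (intro poly_mapping_eqI) (auto simp: lookup_expo in_keys_iff)
      moreover have "restrict (Poly_Mapping.lookup b) U \<in> U \<rightarrow>\<^sub>E {..L}" using True by auto
      ultimately have "b \<in> Y" unfolding Y_def by blast
      then show ?thesis by (rule c(2))
    next
      \<comment> \<open>An entry above L forces a degree above that of every monomial considered, so
        these coefficients vanish without an equation.\<close>
      case False
      then obtain i where "L < Poly_Mapping.lookup b i" by (meson not_le)
      then have "L < tdeg b" using lookup_le_tdeg[of b i] by linarith
      have "b \<notin> Poly_Mapping.keys (list_monom gs \<alpha>)" if "\<alpha> \<in> X0" for \<alpha>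
      proof
        assume "b \<in> Poly_Mapping.keys (list_monom gs \<alpha>)"
        then have "tdeg b \<le> M * sum_list \<alpha>" using M by (rule_tac tdeg_list_monom_le)
        also have "\<dots> \<le> L"
          unfolding L_def using that sum_list_bounded[of \<alpha> B] by (intro mult_le_mono2) (auto simp: X0_def)
        finally show False using \<open>L < tdeg b\<close> by simp
      qed
      then show ?thesis by (intro sum.neutral) (auto simp: in_keys_iff)
    qed
    finally show "Poly_Mapping.lookup (\<Sum>\<alpha>\<in>X. Poly_Mapping.single 0 (c \<alpha>) * list_monom gs \<alpha>) b = 0" .
  qed
qed

lemma up_closed_tdeg_ge: "up_closed (\<lambda>a. d \<le> tdeg a)"
  by (auto simp: up_closed_def tdeg_add)

lemma wreg_length_le:
  fixes fs :: "'k::field mpoly list"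
  assumes "set fs \<subseteq> max_ideal n" "mpoly.wreg n (mono_span n (trunc_ge {1..n} d e)) fs"
    and d: "1 \<le> d" and "t \<le> n" and e: "\<And>i. i \<in> {1..n} \<Longrightarrow> 1 \<le> e i"
    and t: "t + sum e {1..n} + 1 = d + n"
  shows "length fs \<le> t"
proof (rule ccontr)
  assume "\<not> length fs \<le> t"
  let ?I = "mono_span n (trunc_ge {1..n} d e) :: 'k mpoly set"
  let ?H = "mono_span n (\<lambda>a. d \<le> tdeg a) :: 'k mpoly set"
  have I: "mpoly.ideal_in n ?I" by (intro ideal_mono_span up_closed_trunc_ge)
  \<comment> \<open>Terms of elements of the maximal ideal have degree at least 1, so the d-th
    powers lie, like \<open>?I\<close>, in the ideal \<open>?H\<close> of terms of degree at least
    d.\<close>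
  define gs where "gs = map (\<lambda>f. f ^ d) fs"
  have fs: "set fs \<subseteq> carrier (mpoly_ring n)" using assms(1) by (auto simp: max_ideal_eq mono_span_def)
  have gs: "set gs \<subseteq> carrier (mpoly_ring n)" using fs by (auto simp: gs_def)
  have wreg: "mpoly.wreg n ?I gs" unfolding gs_def by (rule mpoly.wreg_map_power[OF I fs assms(2)])
  have "card {1..t} < length gs" using \<open>\<not> length fs \<le> t\<close> by (simp add: gs_def)
  then obtain X c where X: "finite X" "X \<noteq> {}" "\<And>\<alpha>. \<alpha> \<in> X \<Longrightarrow> length \<alpha> = length gs \<and> c \<alpha> \<noteq> 0"
    "\<And>b. Poly_Mapping.keys b \<subseteq> {1..t} \<Longrightarrow>
      Poly_Mapping.lookup (\<Sum>\<alpha>\<in>X. Poly_Mapping.single 0 (c \<alpha>) * list_monom gs \<alpha>) b = 0"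
    using algebraic_dependence[of "{1..t}" gs] by blast
  define F where "F = (\<Sum>\<alpha>\<in>X. Poly_Mapping.single 0 (c \<alpha>) * list_monom gs \<alpha>)"
  have scal: "Poly_Mapping.single 0 x \<in> carrier (mpoly_ring n)" for x :: 'k
    by (simp add: mem_mpoly_ring_iff)
  have F: "F \<in> carrier (mpoly_ring n)"
    unfolding F_def by (intro mpoly.sum_mem mpoly.mult_mem mpoly.list_monom_mem scal gs)
  \<comment> \<open>Lowering the last n - t bounds by one leaves total degree d - 1 by the choice of
    t, and restoring any one of them gives degree d within the bounds.\<close>
  define u where "u = expo {1..n} (\<lambda>i. if i \<le> t then e i else e i - 1)"
  have u: "Poly_Mapping.lookup u i = (if i \<in> {1..n} then if i \<le> t then e i else e i - 1 else 0)" for i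
    by (simp add: u_def lookup_expo)
  have ku: "Poly_Mapping.keys u \<subseteq> {1..n}" by (auto simp: in_keys_iff u split: if_splits)
  have sum_u: "(\<Sum>i\<in>{1..n}. Poly_Mapping.lookup u i) + 1 = d"
  proof -
    have "(\<Sum>i\<in>{1..n}. Poly_Mapping.lookup u i) + card {i\<in>{1..n}. t < i}
        = (\<Sum>i\<in>{1..n}. Poly_Mapping.lookup u i + (if t < i then 1 else 0))"
      by (simp add: sum.distrib sum.If_cases Int_def)
    also have "\<dots> = sum e {1..n}"
      using e by (intro sum.cong) (fastforce simp: u)+
    also have "{i\<in>{1..n}. t < i} = {t<..n}" by auto
    finally show ?thesis using t \<open>t \<le> n\<close> by simp
  qed
  have "F * mon u \<in> ?I"
  proof -
    \<comment> \<open>F has no term in the variables 1, ..., t alone, so a involves some i > t, and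
      there u has room for one more.\<close>
    have "trunc_ge {1..n} d e (u + a)" if a: "a \<in> Poly_Mapping.keys F" for a
    proof -
      from a X(4)[of a] have "\<not> Poly_Mapping.keys a \<subseteq> {1..t}" by (auto simp: F_def in_keys_iff)
      moreover have "Poly_Mapping.keys a \<subseteq> {1..n}" using a F by (auto simp: mem_mpoly_ring_iff)
      ultimately obtain i where i: "i \<in> {1..n}" "t < i" "i \<in> Poly_Mapping.keys a" by force
      have "Poly_Mapping.lookup u j + (if j = i then 1 else 0) \<le> min (Poly_Mapping.lookup (u + a) j) (e j)"
        if "j \<in> {1..n}" for j
        using that i e[of j] by (auto simp: u lookup_add in_keys_iff)
      then have "(\<Sum>j\<in>{1..n}. Poly_Mapping.lookup u j + (if j = i then 1 else 0))
          \<le> (\<Sum>j\<in>{1..n}. min (Poly_Mapping.lookup (u + a) j) (e j))"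
        by (rule sum_mono)
      then have "d \<le> (\<Sum>j\<in>{1..n}. min (Poly_Mapping.lookup (u + a) j) (e j))"
        using i sum_u by (simp add: sum.distrib)
      then show ?thesis by (simp add: trunc_ge_def)
    qed
    moreover have "mon u * F \<in> carrier (mpoly_ring n)" using F ku by (simp add: mon_mem)
    ultimately show ?thesis by (subst mult.commute) (auto simp: mono_span_def keys_mon_mult)
  qed
  moreover have "\<exists>v\<in>carrier (mpoly_ring n). v * Poly_Mapping.single 0 (c \<alpha>) = 1" if "\<alpha> \<in> X" for \<alpha>
    using X(3)[OF that] scal[of "inverse (c \<alpha>)"]
    by (intro bexI[of _ "Poly_Mapping.single 0 (inverse (c \<alpha>))"]) (auto simp: mult_single)
  ultimately have "mon u \<in> mpoly.adjoin_list n ?I gs"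
    using X(1-3) scal mon_mem[OF ku] unfolding F_def
    by (intro mpoly.wreg_relation[OF I gs wreg, where X = X and c = "\<lambda>\<alpha>. Poly_Mapping.single 0 (c \<alpha>)"])
       auto
  also have "\<dots> \<subseteq> ?H"
  proof (rule mpoly.adjoin_list_subset)
    show "mpoly.ideal_in n ?H" by (intro ideal_mono_span up_closed_tdeg_ge)
    show "?I \<subseteq> ?H"
    proof
      fix p assume p: "p \<in> ?I"
      have "d \<le> tdeg a" if a: "a \<in> Poly_Mapping.keys p" for a
      proof -
        have k: "Poly_Mapping.keys a \<subseteq> {1..n}" using a p by (auto simp: mono_span_def mem_mpoly_ring_iff)
        with a p have "d \<le> (\<Sum>i\<in>{1..n}. min (Poly_Mapping.lookup a i) (e i))"
          by (auto simp: mono_span_def trunc_ge_def)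
        also have "\<dots> \<le> (\<Sum>i\<in>{1..n}. Poly_Mapping.lookup a i)" by (intro sum_mono) auto
        finally show ?thesis using k by (simp add: tdeg_eq_sum[of "{1..n}"])
      qed
      with p show "p \<in> ?H" by (auto simp: mono_span_def)
    qed
    have "d \<le> tdeg a" if "f \<in> set fs" "a \<in> Poly_Mapping.keys (f ^ d)" for f a
    proof -
      have "1 \<le> tdeg b" if "b \<in> Poly_Mapping.keys f" for b
      proof -
        have "b \<noteq> 0" using that \<open>f \<in> set fs\<close> assms(1) by (auto simp: max_ideal_eq mono_span_def)
        then obtain i where "i \<in> Poly_Mapping.keys b" using keys_eq_empty by blast
        then show ?thesis using lookup_le_tdeg[of b i] by (auto simp: in_keys_iff)
      qed
      from tdeg_power_ge[OF this that(2)] show ?thesis by simp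
    qed
    with gs show "set gs \<subseteq> ?H" by (auto simp: gs_def mono_span_def)
  qed
  finally have "d \<le> tdeg u" by (auto simp: mono_span_def mon_def)
  moreover have "tdeg u + 1 = d" using sum_u ku by (simp add: tdeg_eq_sum[of "{1..n}"])
  ultimately show False by simp
qed

text \<open>The bounds on t delimit where the formula can hold: t > n would mean that the e_i sum to
  less than d - 1, so that I = 0 and the depth is n, and a negative t is no depth.\<close>

theorem theorem3p3:
  fixes S :: "('k::field) mpoly ring"
    and I :: "'k mpoly set"
    and n d :: nat
    and e :: "nat \<Rightarrow> nat"
    and t :: int
  assumes "S = mpoly_ring n"
    and "1 \<le> n"
    and "1 \<le> d"
    and "1 \<le> e 1"
    and "\<And>i j. 1 \<le> i \<Longrightarrow> i \<le> j \<Longrightarrow> j \<le> n \<Longrightarrow> e i \<le> e j"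
    and "e n \<le> d"
    and "t = int d + int n - 1 - (\<Sum>i = 1..n. int (e i))"
    and "0 \<le> t" and "t \<le> int n"
    and "I = veronese_ideal n d e"
  shows "depth S (max_ideal n) (quotient_module S I) = enat (nat t)"
proof -
  define k where "k = nat t"
  have k: "k \<le> n" "k + sum e {1..n} + 1 = d + n"
    using assms(7-9) by (simp_all add: k_def flip: of_nat_sum)
  have e: "1 \<le> e i" if "i \<in> {1..n}" for i
    using that assms(4) assms(5)[of 1 i] by auto
  have I: "I = mono_span n (trunc_ge {1..n} d e)" using assms(10) by (simp add: veronese_ideal_eq)
  have idI: "mpoly.ideal_in n I" unfolding I by (intro ideal_mono_span up_closed_trunc_ge)
  have m: "mpoly.ideal_in n (max_ideal n :: 'k mpoly set)"
    unfolding max_ideal_eq by (rule ideal_mono_span) (auto simp: up_closed_def simp flip: keys_eq_empty simp: keys_plus_nat)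
  have es: "set (elem_syms n k) \<subseteq> (max_ideal n :: 'k mpoly set)"
    using elem_syms_props by (fastforce simp: max_ideal_eq mono_span_def)
  \<comment> \<open>Since d \<ge> 1, everything stays inside the maximal ideal, which omits 1. This
    supplies the properness that weak regularity leaves out.\<close>
  have "I \<subseteq> max_ideal n"
    using \<open>1 \<le> d\<close> by (auto simp: I max_ideal_eq mono_span_def trunc_ge_def)
  then have "mpoly.adjoin_list n I (elem_syms n k) \<subseteq> max_ideal n"
    using es by (rule mpoly.adjoin_list_subset[OF m])
  moreover have "1 \<notin> (max_ideal n :: 'k mpoly set)" by (auto simp: max_ideal_eq mono_span_def)
  ultimately have "mpoly.adjoin_list n I (elem_syms n k) \<noteq> carrier (mpoly_ring n)"
    using mpoly.one_mem by blast
  moreover have "mpoly.wreg n I (elem_syms n k)"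
    unfolding I using k by (intro wreg_trunc_ge) auto
  moreover have "set (elem_syms n k) \<subseteq> carrier (mpoly_ring n :: 'k mpoly ring)"
    using elem_syms_props by blast
  ultimately have "regular_sequence S (quotient_module S I) (elem_syms n k)"
    by (simp add: assms(1) regular_sequence_quotient_iff[OF idI])
  with es have "enat k \<le> depth S (max_ideal n) (quotient_module S I)"
    unfolding depth_def by (intro Sup_upper) (force intro: exI[of _ "elem_syms n k"])
  moreover have "length fs \<le> k" if "set fs \<subseteq> max_ideal n" "regular_sequence S (quotient_module S I) fs" for fs
  proof (rule wreg_length_le[OF that(1) _ \<open>1 \<le> d\<close> k(1) e k(2)])
    show "mpoly.wreg n (mono_span n (trunc_ge {1..n} d e)) fs"
      using that(2) by (simp only: assms(1) regular_sequence_quotient_iff[OF idI]) (simp add: I)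
  qed
  then have "depth S (max_ideal n) (quotient_module S I) \<le> enat k"
    unfolding depth_def by (intro Sup_least) auto
  ultimately show ?thesis by (simp add: k_def)
qed

end
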